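(* Let $k\ge 1$ and let $\boldsymbol{b}$ be a braid on $k$ strands with closure $\hat{\boldsymbol{b}}$ (an oriented link with its blackboard framing). (1) If $\beta$ is generic, then $P(\boldsymbol{b})$ is the (framed) Homfly-Pt polynomial of $\hat{\boldsymbol{b}}$, i.e. $P(\boldsymbol{b})=H(\hat{\boldsymbol{b}})\,\mathbf{1}_{\mathbf{0}}$ in $\mathrm{End}_{\dot{\mathbf U}_q(\mathfrak{gl}_{k+k})_\beta}(\mathbf{1}_{\mathbf{0}})$. (2) If $\beta=m\in\mathbb{Z}$ with $m\ge 2$, then $P(\boldsymbol{b})$ is the (framed) $\mathfrak{sl}_m$ link invariant of $\hat{\boldsymbol{b}}$, i.e. $P(\boldsymbol{b})=H_m(\hat{\boldsymbol{b}})\,\mathbf{1}_{\mathbf{0}}$.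
   Context: **Base field.** $\beta$ is either an integer or a formal variable ("$\beta$ generic"). We work over $\mathbb{C}(q,q^\beta)$, which is $\mathbb{C}(q)$ if $\beta\in\mathbb{Z}$, and a purely transcendental extension of $\mathbb{C}(q)$ by the element $q^\beta$ if $\beta$ is generic. For $x\in\mathbb{Z}+\mathbb{Z}\beta$ put $[x]=\frac{q^x-q^{-x}}{q-q^{-1}}$. $\mathbb{N}=\{0,1,2,\dots\}$. **Doubled Schur algebra.** For $k,l\ge 0$, let $\mathsf{P}^\beta_{k,l}$ be the set of sequences $\lambda=(\lambda_1,\dots,\lambda_{k+l})$ with $\lambda_i\in\mathbb{N}$ for $i\le k$ and $\lambda_i\in\beta-\mathbb{N}$ for $i\ge k+1$. Let $\alpha_i=(0,\dots,0,1,-1,0,\dots,0)$ with $1$ in position $i$, $1\le i\le k+l-1$. $\dot{\mathbf U}_q(\mathfrak{gl}_{k+l})_\beta$ is the $\mathbb{C}(q,q^\beta)$-linear category with objects $\mathbf{1}_\lambda$, $\lambda\in\mathsf{P}^\beta_{k,l}$, and a zero object; morphisms are generated by the identities $\mathbf{1}_\lambda$ and by $E_i\mathbf{1}_\lambda\in\mathrm{Hom}(\mathbf{1}_\lambda,\mathbf{1}_{\lambda+\alpha_i})$, $F_i\mathbf{1}_\lambda\in\mathrm{Hom}(\mathbf{1}_\lambda,\mathbf{1}_{\lambda-\alpha_i})$, subject to: $\mathbf{1}_\lambda\mathbf{1}_{\lambda'}=\delta_{\lambda,\lambda'}\mathbf{1}_\lambda$; $(E_iF_j-F_jE_i)\mathbf{1}_\lambda=\delta_{i,j}[\lambda_i-\lambda_{i+1}]\mathbf{1}_\lambda$;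 $E_i^2E_j\mathbf{1}_\lambda-(q+q^{-1})E_iE_jE_i\mathbf{1}_\lambda+E_jE_i^2\mathbf{1}_\lambda=0$ and $F_i^2F_j\mathbf{1}_\lambda-(q+q^{-1})F_iF_jF_i\mathbf{1}_\lambda+F_jF_i^2\mathbf{1}_\lambda=0$ for $j=i\pm1$; $E_iE_j\mathbf{1}_\lambda=E_jE_i\mathbf{1}_\lambda$ and $F_iF_j\mathbf{1}_\lambda=F_jF_i\mathbf{1}_\lambda$ for $|i-j|>1$. Any $\mathbf{1}_\mu$ with $\mu\notin\mathsf{P}^\beta_{k,l}$ is the zero object, so a monomial passing through such a weight is zero. Products are composed right to left. **Braids.** Braids are read from bottom to top, strands oriented upward. $\sigma_i$ denotes the positive crossing of strands $i,i+1$ in which the strand going from bottom-left to top-right passes over; $\sigma_i^{-1}$ is the one in which the strand going from bottom-right to top-left passes over. Assign $\sigma_i\mapsto q^{-1}-E_iF_i$ and $\sigma_i^{-1}\mapsto q-E_iF_i$, acting on weights with $\lambda_i=\lambda_{i+1}=1$; composing right to left as the braid is read bottom to top, a braid $\boldsymbol{b}$ on $k$ strands gives an element, also denoted $\boldsymbol{b}$, of $\mathrm{End}_{\dot{\mathbf U}_q(\mathfrak{gl}_{k+k})_\beta}(\mathbf{1}_{(1^k,(\beta-1)^k)})$ involving only $E_i,F_i$ with $i\le k-1$. **Closure.** Let $\mathbf{0}=(0,\dots,0,\beta,\dots,\beta)\in\mathsf{P}^\beta_{k,k}$. For $1\le j\le k$ put $D_j=F_k\,(F_{k+1}F_{k+2}\cdots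 F_{k+j-1})\,(F_{k-1}F_{k-2}\cdots F_{k-j+1})$ and $D_j^*=(E_{k-j+1}\cdots E_{k-2}E_{k-1})\,(E_{k+j-1}\cdots E_{k+2}E_{k+1})\,E_k$ (empty products are identities). The nested caps are $D_kD_{k-1}\cdots D_1:\mathbf{1}_{(1^k,(\beta-1)^k)}\to\mathbf{1}_{\mathbf{0}}$, and the nested cups are $D_1^*D_2^*\cdots D_k^*:\mathbf{1}_{\mathbf{0}}\to\mathbf{1}_{(1^k,(\beta-1)^k)}$. Define $P(\boldsymbol{b})=D_k\cdots D_1\,\boldsymbol{b}\,D_1^*\cdots D_k^*\in\mathrm{End}(\mathbf{1}_{\mathbf{0}})$. **Link polynomials.** The framed Homfly-Pt polynomial $H$ (here $\beta$ is generic) is the invariant of oriented framed links with values in $\mathbb{C}(q,q^\beta)$ determined by: $H(L_+)-H(L_-)=(q^{-1}-q)H(L_0)$ for blackboard-framed diagrams differing only near one crossing, which is positive in $L_+$, negative in $L_-$, and replaced by its oriented smoothing in $L_0$; removing a positive (resp. negative) kink from a diagram changes the value by $H(\text{with kink})=q^{-\beta}H(\text{without kink})$ (resp. $q^{\beta}$); and $H=[\beta]$ on the $0$-framed unknot. The framed $\mathfrak{sl}_m$ invariant $H_m$ is given by the same rules with $q^\beta$ replaced by $q^m$ (so the unknot has value $[m]$). *)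

theory Defs
  imports
    "HOL-Library.Poly_Mapping"
    "HOL-Computational_Algebra.Computational_Algebra"
begin

section \<open>Base fields and quantum integers\<close>

text \<open>
  Everything below depends on the base field only through the map \<open>x \<mapsto> q\<^sup>x\<close>, passed around as
  \<open>qp\<close>; in particular \<open>q = qp 1\<close>.

  Generic case: \<open>\<int> + \<int>\<beta>\<close> sits inside \<open>\<int>[\<beta>]\<close> (type \<open>int poly\<close>), and \<open>\<complex>(q,q\<^sup>\<beta>)\<close> is the field of
  rational functions in the variable \<open>q\<^sup>\<beta>\<close> over \<open>\<complex>(q)\<close>. The value of \<open>qpow_gen\<close> is meaningful only
  on polynomials of degree at most one, the only ones that occur as entries of weights.
\<close>

definition beta_gen :: "int poly" where
  "beta_gen = [:0, 1:]"

definition qpow_int :: "int \<Rightarrow> complex poly fract" where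
  "qpow_int x = Fract [:0, 1:] 1 powi x"

definition qpow_gen :: "int poly \<Rightarrow> complex poly fract poly fract" where
  "qpow_gen x = Fract [:qpow_int (coeff x 0):] 1 * Fract [:0, 1:] 1 powi coeff x 1"

definition qbracket :: "('w::ring_1 \<Rightarrow> 'f::field) \<Rightarrow> 'w \<Rightarrow> 'f" where
  "qbracket qp x = (qp x - qp (- x)) / (qp 1 - qp (- 1))"


section \<open>The doubled Schur algebra\<close>

text \<open>
  A word \<open>[g\<^sub>1, \<dots>, g\<^sub>r]\<close> stands for the composite \<open>g\<^sub>1 \<cdots> g\<^sub>r\<close>, whose rightmost letter acts first.
  With concatenation as the monoid operation, \<open>gen list \<Rightarrow>\<^sub>0 'f\<close> is the free associative algebra on
  the letters \<open>E\<^sub>i\<close>, \<open>F\<^sub>i\<close>.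
\<close>

datatype gen = E nat | F nat

instantiation list :: (type) monoid_add
begin

definition zero_list :: "'a list" where
  "zero_list = []"

definition plus_list :: "'a list \<Rightarrow> 'a list \<Rightarrow> 'a list" where
  "plus_list = (@)"

instance
  by standard (simp_all add: zero_list_def plus_list_def)

end

type_synonym 'f free_alg = "gen list \<Rightarrow>\<^sub>0 'f"

definition scalar :: "'f::field \<Rightarrow> 'f free_alg" where
  "scalar c = Poly_Mapping.single [] c"

definition word :: "gen list \<Rightarrow> 'f::field free_alg" where
  "word w = Poly_Mapping.single w 1"

abbreviation EE :: "nat \<Rightarrow> 'f::field free_alg" where
  "EE i \<equiv> word [E i]"

abbreviation FF :: "nat \<Rightarrow> 'f::field free_alg" where
  "FF i \<equiv> word [F i]"

text \<open>
  A weight \<open>(\<nu>\<^sub>1, \<dots>, \<nu>\<^sub>k\<^sub>+\<^sub>l)\<close> is a function on \<open>nat\<close>, of which only the values at \<open>1, \<dots>, k + l\<close>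
  matter.
\<close>

type_synonym 'w weight = "nat \<Rightarrow> 'w"

definition admissible :: "'w::ring_1 \<Rightarrow> nat \<Rightarrow> nat \<Rightarrow> 'w weight \<Rightarrow> bool" where
  "admissible \<beta> k l \<nu> \<longleftrightarrow> (\<forall>i\<in>{1..k}. \<nu> i \<in> \<nat>) \<and> (\<forall>i\<in>{k+1..k+l}. \<beta> - \<nu> i \<in> \<nat>)"

fun letter_index :: "gen \<Rightarrow> nat" where
  "letter_index (E i) = i"
| "letter_index (F i) = i"

fun letter_target :: "gen \<Rightarrow> 'w::ring_1 weight \<Rightarrow> 'w weight" where
  "letter_target (E i) \<nu> = \<nu>(i := \<nu> i + 1, Suc i := \<nu> (Suc i) - 1)"
| "letter_target (F i) \<nu> = \<nu>(i := \<nu> i - 1, Suc i := \<nu> (Suc i) + 1)"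

definition word_target :: "gen list \<Rightarrow> 'w::ring_1 weight \<Rightarrow> 'w weight" where
  "word_target w \<nu> = foldr letter_target w \<nu>"

text \<open>The words that do not leave the set of admissible weights when applied to \<open>1\<^sub>\<nu>\<close>.\<close>

primrec schur_path :: "'w::ring_1 \<Rightarrow> nat \<Rightarrow> nat \<Rightarrow> 'w weight \<Rightarrow> gen list \<Rightarrow> bool" where
  "schur_path \<beta> k l \<nu> [] \<longleftrightarrow> admissible \<beta> k l \<nu>"
| "schur_path \<beta> k l \<nu> (g # w) \<longleftrightarrow>
     schur_path \<beta> k l \<nu> w \<and> letter_index g \<in> {1..<k+l} \<and>
     admissible \<beta> k l (word_target (g # w) \<nu>)"

inductive_set relators :: "('w::ring_1 \<Rightarrow> 'f::field) \<Rightarrow> nat \<Rightarrow> 'w weight \<Rightarrow> 'f free_alg set"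
  for qp :: "'w \<Rightarrow> 'f" and n :: nat and \<nu> :: "'w weight" where
  EF: "\<lbrakk>i \<in> {1..<n}; j \<in> {1..<n}\<rbrakk> \<Longrightarrow>
    EE i * FF j - FF j * EE i
      - scalar (if i = j then qbracket qp (\<nu> i - \<nu> (Suc i)) else 0) \<in> relators qp n \<nu>"
| Serre_E: "\<lbrakk>i \<in> {1..<n}; j \<in> {1..<n}; j = Suc i \<or> i = Suc j\<rbrakk> \<Longrightarrow>
    EE i * EE i * EE j - scalar (qp 1 + inverse (qp 1)) * (EE i * EE j * EE i)
      + EE j * EE i * EE i \<in> relators qp n \<nu>"
| Serre_F: "\<lbrakk>i \<in> {1..<n}; j \<in> {1..<n}; j = Suc i \<or> i = Suc j\<rbrakk> \<Longrightarrow>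
    FF i * FF i * FF j - scalar (qp 1 + inverse (qp 1)) * (FF i * FF j * FF i)
      + FF j * FF i * FF i \<in> relators qp n \<nu>"
| far_E: "\<lbrakk>i \<in> {1..<n}; j \<in> {1..<n}; Suc i < j \<or> Suc j < i\<rbrakk> \<Longrightarrow>
    EE i * EE j - EE j * EE i \<in> relators qp n \<nu>"
| far_F: "\<lbrakk>i \<in> {1..<n}; j \<in> {1..<n}; Suc i < j \<or> Suc j < i\<rbrakk> \<Longrightarrow>
    FF i * FF j - FF j * FF i \<in> relators qp n \<nu>"

text \<open>
  A path in the category is determined by its source and its sequence of letters, so an element of
  the free algebra, once a source \<open>\<nu>\<close> is fixed, represents a morphism out of \<open>1\<^sub>\<nu>\<close> (more precisely
  an element of \<open>\<Oplus>\<^sub>\<mu> Hom(1\<^sub>\<nu>, 1\<^sub>\<mu>)\<close>). The set \<open>schur_null qp \<beta> k l \<nu>\<close> consists of the elements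
  that represent zero.
\<close>

inductive_set schur_null ::
  "('w::ring_1 \<Rightarrow> 'f::field) \<Rightarrow> 'w \<Rightarrow> nat \<Rightarrow> nat \<Rightarrow> 'w weight \<Rightarrow> 'f free_alg set"
  for qp :: "'w \<Rightarrow> 'f" and \<beta> :: 'w and k l :: nat and \<nu> :: "'w weight" where
  zero: "0 \<in> schur_null qp \<beta> k l \<nu>"
| add: "\<lbrakk>x \<in> schur_null qp \<beta> k l \<nu>; y \<in> schur_null qp \<beta> k l \<nu>\<rbrakk> \<Longrightarrow> x + y \<in> schur_null qp \<beta> k l \<nu>"
| scale: "x \<in> schur_null qp \<beta> k l \<nu> \<Longrightarrow> scalar c * x \<in> schur_null qp \<beta> k l \<nu>"
| leave: "\<not> schur_path \<beta> k l \<nu> w \<Longrightarrow> word w \<in> schur_null qp \<beta> k l \<nu>"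
| rel: "r \<in> relators qp (k + l) (word_target w \<nu>) \<Longrightarrow>
    word u * r * word w \<in> schur_null qp \<beta> k l \<nu>"

definition schur_eq ::
  "('w::ring_1 \<Rightarrow> 'f::field) \<Rightarrow> 'w \<Rightarrow> nat \<Rightarrow> nat \<Rightarrow> 'w weight \<Rightarrow> 'f free_alg \<Rightarrow> 'f free_alg \<Rightarrow> bool" where
  "schur_eq qp \<beta> k l \<nu> x y \<longleftrightarrow> x - y \<in> schur_null qp \<beta> k l \<nu>"

definition zero_weight :: "'w::ring_1 \<Rightarrow> nat \<Rightarrow> 'w weight" where
  "zero_weight \<beta> k = (\<lambda>i. if i \<le> k then 0 else \<beta>)"


section \<open>Braids and their closure in the doubled Schur algebra\<close>

text \<open>
  A braid is given by a word in the \<open>\<sigma>\<^sub>i\<^sup>\<plusminus>\<^sup>1\<close>, listed from bottom to top: \<open>(i, True)\<close> is \<open>\<sigma>\<^sub>i\<close> and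
  \<open>(i, False)\<close> is its inverse.
\<close>

type_synonym braid = "(nat \<times> bool) list"

definition is_braid :: "nat \<Rightarrow> braid \<Rightarrow> bool" where
  "is_braid k b \<longleftrightarrow> (\<forall>(i, s) \<in> set b. 1 \<le> i \<and> i < k)"

definition braid_elt :: "('w::ring_1 \<Rightarrow> 'f::field) \<Rightarrow> braid \<Rightarrow> 'f free_alg" where
  "braid_elt qp b =
     prod_list (map (\<lambda>(i, s). scalar (if s then inverse (qp 1) else qp 1) - EE i * FF i) (rev b))"

definition cap_elt :: "nat \<Rightarrow> nat \<Rightarrow> 'f::field free_alg" where
  "cap_elt k j = word ([F k] @ map F [k+1..<k+j] @ map F (rev [k+1-j..<k]))"

definition cup_elt :: "nat \<Rightarrow> nat \<Rightarrow> 'f::field free_alg" where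
  "cup_elt k j = word (map E [k+1-j..<k] @ map E (rev [k+1..<k+j]) @ [E k])"

definition braid_closure_elt :: "('w::ring_1 \<Rightarrow> 'f::field) \<Rightarrow> nat \<Rightarrow> braid \<Rightarrow> 'f free_alg" where
  "braid_closure_elt qp k b =
     prod_list (map (cap_elt k) (rev [1..<k+1])) * braid_elt qp b *
     prod_list (map (cup_elt k) [1..<k+1])"


section \<open>Oriented framed links\<close>

text \<open>
  An oriented link diagram in the plane, in general position with respect to the height function,
  is recorded by listing its critical points and crossings from bottom to top. Each is paired with
  the number of strands to its left. Orientations of strands at a given height are booleans,
  \<open>True\<close> meaning upward.

  \<^item> \<open>Cup d\<close> is a local minimum whose left end has orientation \<open>d\<close> (and its right end \<open>\<not> d\<close>).
  \<^item> \<open>Cap\<close> is a local maximum; it requires two neighbouring strands of opposite orientation.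
  \<^item> \<open>Cross s\<close> is a crossing, with \<open>s\<close> true iff the strand from bottom left to top right passes over,
    whatever the orientations of the two strands are.
\<close>

datatype elementary = Cup bool | Cap | Cross bool

type_synonym diagram = "(nat \<times> elementary) list"

text \<open>The sequence of orientations just above an elementary piece, from the one just below it.\<close>

fun pass :: "nat \<times> elementary \<Rightarrow> bool list \<Rightarrow> bool list option" where
  "pass (i, Cup d) st =
     (if i \<le> length st then Some (take i st @ [d, \<not> d] @ drop i st) else None)"
| "pass (i, Cap) st =
     (if Suc i < length st \<and> st ! i \<noteq> st ! Suc i then Some (take i st @ drop (i + 2) st) else None)"
| "pass (i, Cross s) st =
     (if Suc i < length st then Some (take i st @ [st ! Suc i, st ! i] @ drop (i + 2) st) else None)"

primrec boundary :: "diagram \<Rightarrow> bool list \<Rightarrow> bool list option" where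
  "boundary [] st = Some st"
| "boundary (e # D) st = Option.bind (pass e st) (boundary D)"

definition link_diagram :: "diagram \<Rightarrow> bool" where
  "link_diagram D \<longleftrightarrow> boundary D [] = Some []"

primrec strands_in :: "elementary \<Rightarrow> nat" where
  "strands_in (Cup d) = 0"
| "strands_in Cap = 2"
| "strands_in (Cross s) = 2"

primrec strands_out :: "elementary \<Rightarrow> nat" where
  "strands_out (Cup d) = 2"
| "strands_out Cap = 0"
| "strands_out (Cross s) = 2"

text \<open>
  A kink on a strand of orientation \<open>d\<close>, with its loop to the right or to the left. In both cases
  the two strands at the crossing are parallel, so the kink is positive iff \<open>s\<close> holds.
\<close>

definition kink_right :: "nat \<Rightarrow> bool \<Rightarrow> bool \<Rightarrow> diagram" where
  "kink_right i d s = [(i + 1, Cup d), (i, Cross s), (i + 1, Cap)]"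

definition kink_left :: "nat \<Rightarrow> bool \<Rightarrow> bool \<Rightarrow> diagram" where
  "kink_left i d s = [(i, Cup (\<not> d)), (i + 1, Cross s), (i, Cap)]"

text \<open>
  The local moves on diagrams with blackboard framing. The moves \<open>interchange\<close> (of pieces that lie
  side by side), \<open>zigzag\<close> and \<open>slide\<close> generate planar isotopy; the others are the second and third
  Reidemeister moves and the framed version of the first, which trades a kink for the kink of the
  same sign on the other side. In \<open>R3\<close> the strands at positions \<open>i\<close>, \<open>i + 1\<close>, \<open>i + 2\<close> are pairwise
  above or below each other according to \<open>s\<close> (first and second), \<open>t\<close> (first and third) and \<open>r\<close>
  (second and third); the side condition excludes the two cyclic patterns.
\<close>

inductive local_move :: "diagram \<Rightarrow> diagram \<Rightarrow> bool" where
  interchange: "local_move [(i + strands_in A + d, B), (i, A)] [(i, A), (i + strands_out A + d, B)]"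
| zigzag_right: "local_move [(i, Cup d), (i + 1, Cap)] []"
| zigzag_left: "local_move [(i + 1, Cup d), (i, Cap)] []"
| slide_cap: "local_move [(i, Cross s), (i + 1, Cap)] [(i + 1, Cross (\<not> s)), (i, Cap)]"
| slide_cup: "local_move [(i + 1, Cup d), (i, Cross s)] [(i, Cup d), (i + 1, Cross (\<not> s))]"
| R2: "local_move [(i, Cross s), (i, Cross (\<not> s))] []"
| R3: "\<not> (s = r \<and> t \<noteq> s) \<Longrightarrow>
    local_move [(i, Cross s), (i + 1, Cross t), (i, Cross r)]
               [(i + 1, Cross r), (i, Cross t), (i + 1, Cross s)]"
| framed_R1: "local_move (kink_right i d s) (kink_left i d s)"

inductive diagram_move :: "diagram \<Rightarrow> diagram \<Rightarrow> bool" where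
  "\<lbrakk>local_move A B; link_diagram (U @ A @ V); link_diagram (U @ B @ V)\<rbrakk> \<Longrightarrow>
    diagram_move (U @ A @ V) (U @ B @ V)"

definition framed_isotopic :: "diagram \<Rightarrow> diagram \<Rightarrow> bool" where
  "framed_isotopic = equivclp diagram_move"

text \<open>
  The framed Homfly-Pt rules, with \<open>a\<close> in the role of \<open>q\<^sup>\<beta>\<close>. In the skein rule \<open>x\<close> and \<open>y\<close> are the
  orientations of the lower left and lower right strands at the crossing, which is positive iff
  the strand from bottom left to top right is over and \<open>x = y\<close>, or it is under and \<open>x \<noteq> y\<close>. If
  \<open>x \<noteq> y\<close>, the oriented smoothing consists of a cap below a cup.
\<close>

definition oriented_smoothing :: "nat \<Rightarrow> bool \<Rightarrow> bool \<Rightarrow> diagram" where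
  "oriented_smoothing i x y = (if x = y then [] else [(i, Cap), (i, Cup y)])"

definition framed_homfly :: "'f::field \<Rightarrow> 'f \<Rightarrow> (diagram \<Rightarrow> 'f) \<Rightarrow> bool" where
  "framed_homfly q a H \<longleftrightarrow>
    (\<forall>D D'. link_diagram D \<and> framed_isotopic D D' \<longrightarrow> H D = H D') \<and>
    (\<forall>U V i s st x y.
       link_diagram (U @ [(i, Cross s)] @ V) \<and> boundary U [] = Some st \<and>
       x = st ! i \<and> y = st ! Suc i \<longrightarrow>
       H (U @ [(i, Cross (x = y))] @ V) - H (U @ [(i, Cross (x \<noteq> y))] @ V)
         = (inverse q - q) * H (U @ oriented_smoothing i x y @ V)) \<and>
    (\<forall>U V i d s K.
       K \<in> {kink_right i d s, kink_left i d s} \<and> link_diagram (U @ K @ V) \<longrightarrow>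
       H (U @ K @ V) = (if s then inverse a else a) * H (U @ V)) \<and>
    (\<forall>d. H [(0, Cup d), (0, Cap)] = (a - inverse a) / (q - inverse q))"

text \<open>
  The closing strands run downward to the right of the braid. A braid generator \<open>\<sigma>\<^sub>i\<close> has \<open>i - 1\<close>
  strands to its left.
\<close>

definition braid_closure :: "nat \<Rightarrow> braid \<Rightarrow> diagram" where
  "braid_closure k b =
     map (\<lambda>i. (i, Cup True)) [0..<k] @ map (\<lambda>(i, s). (i - 1, Cross s)) b @
     map (\<lambda>i. (i, Cap)) (rev [0..<k])"

end

theory Submission
  imports Defs
begin

text \<open>
  Both sides are determined by the same Markov-type recursion. Modulo braid relations, \<open>R2\<close> and the
  skein relation, a braid on \<open>k + 1\<close> strands reduces to braids \<open>x\<close> and \<open>x \<sigma>\<^sub>k y\<close> with \<open>x\<close>, \<open>y\<close> on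
  \<open>k\<close> strands, so an invariant is fixed by its values under the two partial closures of the last
  strand. For link diagrams these are a disjoint circle, of value \<open>[\<beta>]\<close>, and a positive kink, of
  value \<open>q\<^sup>-\<^sup>\<beta>\<close>. In the doubled Schur algebra, with \<open>n\<close> fixed and \<open>1\<^sup>k0\<^sup>n\<^sup>-\<^sup>k\<close> on the left, one
  computes \<open>D\<^sub>n\<^sub>-\<^sub>k D\<^sub>n\<^sub>-\<^sub>k\<^sup>* = [\<beta>]\<close> and \<open>D\<^sub>n\<^sub>-\<^sub>k E\<^sub>kF\<^sub>k D\<^sub>n\<^sub>-\<^sub>k\<^sup>* = [\<beta> - 1]\<close>, and
  \<open>q\<^sup>-\<^sup>1[\<beta>] - [\<beta> - 1] = q\<^sup>-\<^sup>\<beta>\<close>. Keeping \<open>n\<close> fixed while \<open>k\<close> grows avoids comparing the algebras of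
  different ranks.
\<close>

section \<open>Reduction of braid words\<close>

text \<open>Signs are left out, since the skein relation takes care of them later. Repeated letters
  are never cancelled, so equivalence preserves the length, on which the later induction
  depends.\<close>

inductive braid_step :: "nat list \<Rightarrow> nat list \<Rightarrow> bool" where
  far: "Suc i < j \<Longrightarrow> braid_step (u @ [i, j] @ v) (u @ [j, i] @ v)"
| braid: "braid_step (u @ [i, Suc i, i] @ v) (u @ [Suc i, i, Suc i] @ v)"

abbreviation braid_equiv :: "nat list \<Rightarrow> nat list \<Rightarrow> bool" where
  "braid_equiv \<equiv> equivclp braid_step"

lemma braid_step_context: "braid_step w w' \<Longrightarrow> braid_step (x @ w @ y) (x @ w' @ y)"
proof (induction rule: braid_step.induct)
  case (far i j u v)
  then show ?case using braid_step.far[of i j "x @ u" "v @ y"] by simp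
next
  case (braid u i v)
  then show ?case using braid_step.braid[of "x @ u" i "v @ y"] by simp
qed

lemma braid_equiv_context: "braid_equiv w w' \<Longrightarrow> braid_equiv (x @ w @ y) (x @ w' @ y)"
proof (induction rule: equivclp_induct)
  case base
  then show ?case by simp
next
  case (step w' w'')
  then have "braid_equiv (x @ w' @ y) (x @ w'' @ y)"
    using braid_step_context by (meson r_into_equivclp equivclp_sym)
  with step.IH show ?case by (rule equivclp_trans)
qed

lemma braid_equiv_set: "braid_equiv w w' \<Longrightarrow> set w' = set w"
proof (induction rule: equivclp_induct)
  case (step w' w'')
  have "set b = set a" if "braid_step a b" for a b
    using that by induction auto
  with step show ?case by blast
qed simp

lemma braid_equiv_length: "braid_equiv w w' \<Longrightarrow> length w' = length w"
proof (induction rule: equivclp_induct)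
  case (step w' w'')
  have "length b = length a" if "braid_step a b" for a b
    using that by induction auto
  with step show ?case by metis
qed simp

lemma braid_equiv_commute:
  assumes "\<forall>i\<in>set x. Suc i < j"
  shows "braid_equiv (x @ [j]) (j # x)"
  using assms
proof (induction x)
  case (Cons i x)
  have "braid_equiv (i # x @ [j]) (i # j # x)"
    using Cons braid_equiv_context[of "x @ [j]" "j # x" "[i]" "[]"] by simp
  also have "braid_equiv \<dots> (j # i # x)"
    using Cons.prems braid_step.far[of i j "[]" x] by (simp add: r_into_equivclp)
  finally show ?case by simp
qed simp

text \<open>The shapes at which rewriting may stop. A \<open>square\<close> may occur anywhere and
  with any letter, because the skein relation turns it into shorter words; \<open>flat\<close> and
  \<open>top\<close> are the words to which the partial closures apply.\<close>

inductive top_reduced :: "nat \<Rightarrow> nat list \<Rightarrow> bool" for k where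
  square: "top_reduced k (u @ [i, i] @ v)"
| flat: "k \<notin> set w \<Longrightarrow> top_reduced k w"
| top: "k \<notin> set x \<Longrightarrow> k \<notin> set y \<Longrightarrow> top_reduced k (x @ [k] @ y)"

text \<open>Two successive top letters enclose a word in lower letters, which is reduced by
  induction. Then either a square appears, or a single next-lower letter lies between the top
  letters and the braid relation removes one of them.\<close>

lemma braid_equiv_top_reduced:
  assumes "set w \<subseteq> {..k}"
  shows "\<exists>w'. braid_equiv w w' \<and> top_reduced k w'"
  using assms
proof (induction k arbitrary: w)
  case 0
  have "top_reduced 0 w"
  proof (cases w)
    case Nil
    then show ?thesis by (simp add: top_reduced.flat)
  next
    case (Cons a w1)
    note w = this
    show ?thesis
    proof (cases w1)
      case Nil
      with w 0 have "w = [] @ [0] @ []" by simp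
      then show ?thesis using top_reduced.top[of 0 "[]" "[]"] by simp
    next
      case (Cons b w2)
      with w 0 have "w = [] @ [0, 0] @ w2" by simp
      then show ?thesis using top_reduced.square[of 0 "[]" 0 w2] by simp
    qed
  qed
  then show ?case by (intro exI[of _ w] conjI) simp_all
next
  case (Suc k)
  note outer = Suc.IH
  show ?case using Suc.prems
  \<comment> \<open>The outer hypothesis reduces words in letters up to \<open>k\<close>; this inner
    induction lowers the number of top letters.\<close>
  proof (induction "count_list w (Suc k)" arbitrary: w rule: less_induct)
    case less
    \<comment> \<open>If there are at least two top letters, the first two are taken, so that
      \<open>x\<close> contains only lower letters.\<close>
    have "top_reduced (Suc k) w \<or> (\<exists>u x y. w = u @ [Suc k] @ x @ [Suc k] @ y \<and> Suc k \<notin> set x)"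
    proof (cases "Suc k \<in> set w")
      case True
      then obtain u z where w: "w = u @ Suc k # z" and u: "Suc k \<notin> set u"
        by (meson split_list_first)
      show ?thesis
      proof (cases "Suc k \<in> set z")
        case True
        then obtain x y where "z = x @ Suc k # y" and "Suc k \<notin> set x"
          by (meson split_list_first)
        with w show ?thesis by auto
      qed (use u w top_reduced.top[of "Suc k" u z] in simp)
    qed (simp add: top_reduced.flat)
    then consider "top_reduced (Suc k) w"
      | u x y where "w = u @ [Suc k] @ x @ [Suc k] @ y" "Suc k \<notin> set x"
      by blast
    then show ?case
    proof cases
      case 1
      then show ?thesis by (intro exI[of _ w] conjI) simp_all
    next
      case 2
      note w = 2(1)
      have "set x \<subseteq> {..k}"
      proof
        fix i assume "i \<in> set x"
        with less.prems 2 have "i \<le> Suc k" "i \<noteq> Suc k" by auto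
        then show "i \<in> {..k}" by simp
      qed
      then obtain x' where x': "braid_equiv x x'" and reduced: "top_reduced k x'"
        using outer by blast
      have ww': "braid_equiv w (u @ [Suc k] @ x' @ [Suc k] @ y)"
        using braid_equiv_context[OF x', of "u @ [Suc k]" "[Suc k] @ y"] by (simp add: w)
      have x'_le: "set x' \<subseteq> {..k}"
        using braid_equiv_set[OF x'] \<open>set x \<subseteq> {..k}\<close> by simp
      have commute: "braid_equiv (c @ [Suc k]) (Suc k # c)" if "set c \<subseteq> {..k}" "k \<notin> set c" for c
      proof (rule braid_equiv_commute, rule ballI)
        fix i assume "i \<in> set c"
        with that have "i \<le> k" "i \<noteq> k" by auto
        then show "Suc i < Suc k" by simp
      qed
      from reduced show ?thesis
      proof cases
        case (square a i b)
        have "top_reduced (Suc k) ((u @ [Suc k] @ a) @ [i, i] @ (b @ [Suc k] @ y))"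
          by (rule top_reduced.square)
        with ww' square show ?thesis by auto
      next
        case flat
        have "braid_equiv w (u @ [Suc k, Suc k] @ x' @ y)"
          using equivclp_trans[OF ww'] braid_equiv_context[OF commute[OF x'_le flat], of "u @ [Suc k]" y]
          by simp
        moreover have "top_reduced (Suc k) (u @ [Suc k, Suc k] @ x' @ y)"
          by (rule top_reduced.square)
        ultimately show ?thesis by blast
      next
        case (top a b)
        have ab_le: "set a \<subseteq> {..k}" "set b \<subseteq> {..k}"
          using x'_le top by auto
        \<comment> \<open>Once \<open>a\<close> and \<open>b\<close> are moved outside the top
          letters, \<open>[Suc k, k, Suc k]\<close> remains and becomes
          \<open>[k, Suc k, k]\<close>, with one top letter fewer.\<close>
        define w2 where "w2 = u @ a @ [k, Suc k, k] @ b @ y"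
        have w1: "braid_equiv w (u @ (Suc k # a) @ [k] @ b @ [Suc k] @ y)"
          using ww' by (simp add: top)
        have w2: "braid_equiv (u @ (Suc k # a) @ [k] @ b @ [Suc k] @ y)
            (u @ (a @ [Suc k]) @ [k] @ b @ [Suc k] @ y)"
          by (rule braid_equiv_context[OF equivclp_sym[OF commute]]) (use ab_le top in auto)
        have w3: "braid_equiv (u @ (a @ [Suc k]) @ [k] @ b @ [Suc k] @ y)
            ((u @ a @ [Suc k, k]) @ (Suc k # b) @ y)"
          using braid_equiv_context[OF commute[of b], of "u @ a @ [Suc k, k]" y] ab_le top by simp
        have w4: "braid_equiv ((u @ a @ [Suc k, k]) @ (Suc k # b) @ y) w2"
          using braid_step.braid[of "u @ a" k "b @ y"]
          by (simp add: w2_def r_into_equivclp equivclp_sym)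
        have ww2: "braid_equiv w w2"
          by (rule equivclp_trans[OF w1 equivclp_trans[OF w2 equivclp_trans[OF w3 w4]]])
        have "Suc k \<notin> set a" "Suc k \<notin> set b"
          using ab_le by auto
        then have "count_list w2 (Suc k) < count_list w (Suc k)"
          by (simp add: w2_def w count_notin)
        moreover have "set w2 \<subseteq> {..Suc k}"
          using braid_equiv_set[OF ww2] less.prems by simp
        ultimately obtain w' where "braid_equiv w2 w'" "top_reduced (Suc k) w'"
          using less.hyps by blast
        then show ?thesis
          using equivclp_trans[OF ww2] by blast
      qed
    qed
  qed
qed

section \<open>Induction over signed braid words\<close>

lemma is_braid_simps [simp]:
  "is_braid k []"
  "is_braid k ((i, s) # b) \<longleftrightarrow> 1 \<le> i \<and> i < k \<and> is_braid k b"
  "is_braid k (b @ c) \<longleftrightarrow> is_braid k b \<and> is_braid k c"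
  by (auto simp: is_braid_def)

lemma is_braid_iff: "is_braid k b \<longleftrightarrow> fst ` set b \<subseteq> {1..<k}"
  by (auto simp: is_braid_def)

text \<open>
  The skein hypothesis makes signs irrelevant modulo shorter words, so an induction on the length
  only has to deal with words in the symmetric group.
\<close>

lemma skein_induct [consumes 1, case_names skein R2 far braid flat top]:
  assumes "is_braid (Suc k) b"
    and skein: "\<And>u v i. is_braid (Suc k) (u @ (i, True) # v) \<Longrightarrow> Q (u @ v) \<Longrightarrow>
      Q (u @ (i, True) # v) \<longleftrightarrow> Q (u @ (i, False) # v)"
    and R2: "\<And>u v i. is_braid (Suc k) (u @ (i, True) # (i, False) # v) \<Longrightarrow> Q (u @ v) \<Longrightarrow>
      Q (u @ (i, True) # (i, False) # v)"
    and far: "\<And>u v i j. is_braid (Suc k) (u @ (i, True) # (j, True) # v) \<Longrightarrow> Suc i < j \<Longrightarrow>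
      Q (u @ (i, True) # (j, True) # v) \<longleftrightarrow> Q (u @ (j, True) # (i, True) # v)"
    and braid: "\<And>u v i. is_braid (Suc k) (u @ (i, True) # (Suc i, True) # (i, True) # v) \<Longrightarrow>
      Q (u @ (i, True) # (Suc i, True) # (i, True) # v) \<longleftrightarrow>
      Q (u @ (Suc i, True) # (i, True) # (Suc i, True) # v)"
    and flat: "\<And>x. is_braid k x \<Longrightarrow> Q x"
    and top: "\<And>x y. 1 \<le> k \<Longrightarrow> is_braid k x \<Longrightarrow> is_braid k y \<Longrightarrow> Q (x @ (k, True) # y)"
  shows "Q b"
  using assms(1)
proof (induction "length b" arbitrary: b rule: less_induct)
  case less
  let ?pos = "map (\<lambda>i. (i, True))"
  have pos_braid: "is_braid l (?pos (map fst c)) \<longleftrightarrow> is_braid l c" for l c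
    by (simp add: is_braid_iff image_comp comp_def)
  \<comment> \<open>Deleting the letter gives a shorter word, for which \<open>Q\<close> is known;
    the skein hypothesis then allows the change of sign.\<close>
  have sign: "Q (u @ (i, True) # v) \<longleftrightarrow> Q (u @ (i, False) # v)"
    if "is_braid (Suc k) (u @ (i, True) # v)" "length u + length v < length b" for u v i
    using that less.hyps[of "u @ v"] skein by simp
  have pos: "Q (u @ c) \<longleftrightarrow> Q (u @ ?pos (map fst c))"
    if "is_braid (Suc k) (u @ c)" "length u + length c \<le> length b" for u c
    using that
  proof (induction c arbitrary: u)
    case (Cons g c)
    obtain i s where g: "g = (i, s)" by fastforce
    have "Q (u @ g # c) \<longleftrightarrow> Q (u @ (i, True) # c)"
      using sign[of u i c] Cons.prems by (cases s) (auto simp: g)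
    then show ?case using Cons.IH[of "u @ [(i, True)]"] Cons.prems by (simp add: g)
  qed simp
  have braid_step_Q: "Q (?pos w) \<longleftrightarrow> Q (?pos w')" if "braid_step w w'" "is_braid (Suc k) (?pos w)" for w w'
    using that
  proof induction
    case (far i j u v)
    then show ?case using assms(4)[of "?pos u" i j "?pos v"] by simp
  next
    case (braid u i v)
    then show ?case using assms(5)[of "?pos u" i "?pos v"] by simp
  qed
  have equiv: "(Q (?pos w) \<longleftrightarrow> Q (?pos w')) \<and> is_braid (Suc k) (?pos w')"
    if "braid_equiv w w'" "is_braid (Suc k) (?pos w)" for w w'
    using that
  proof (induction rule: equivclp_induct)
    case (step w' w'')
    from step(2) have "set w'' = set w'"
    proof
      assume "braid_step w' w''"
      then show ?thesis by (rule braid_equiv_set[OF r_into_equivclp])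
    next
      assume "braid_step w'' w'"
      then show ?thesis using braid_equiv_set[OF r_into_equivclp] by metis
    qed
    then have B: "is_braid (Suc k) (?pos w'')"
      using step by (simp add: is_braid_iff image_comp comp_def)
    from step(2) have "Q (?pos w') \<longleftrightarrow> Q (?pos w'')"
    proof
      assume "braid_step w' w''"
      then show ?thesis using step.IH step.prems braid_step_Q by simp
    next
      assume "braid_step w'' w'"
      then show ?thesis using B braid_step_Q by simp
    qed
    with B show ?case using step.IH step.prems by simp
  qed simp
  have "set (map fst b) \<subseteq> {..k}"
    using less.prems by (auto simp: is_braid_iff)
  then obtain w' where w': "braid_equiv (map fst b) w'" and reduced: "top_reduced k w'"
    using braid_equiv_top_reduced by blast
  have Q: "Q b \<longleftrightarrow> Q (?pos w')" and B: "is_braid (Suc k) (?pos w')"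
    using equiv[OF w'] pos[of "[]" b] less.prems pos_braid by auto
  \<comment> \<open>The rewritten word is as long as \<open>b\<close>, so the induction hypothesis
    still covers what is left after deleting letters.\<close>
  have len: "length w' = length b"
    using braid_equiv_length[OF w'] by simp
  have lower: "is_braid k (?pos x)" if "is_braid (Suc k) (?pos x)" "k \<notin> set x" for x
  proof -
    have "set x \<subseteq> {1..<Suc k} - {k}"
      using that by (auto simp: is_braid_iff image_comp comp_def)
    also have "\<dots> \<subseteq> {1..<k}" by auto
    finally show ?thesis by (simp add: is_braid_iff image_comp comp_def)
  qed
  from reduced have "Q (?pos w')"
  proof cases
    case (square u i v)
    \<comment> \<open>\<open>R2\<close> inserts a letter and its inverse; changing the sign of the
      inverse, again modulo a shorter word, yields the square.\<close>
    have "Q (?pos u @ ?pos v)"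
      using less.hyps[of "?pos u @ ?pos v"] B len by (simp add: square)
    then have "Q (?pos u @ (i, True) # (i, False) # ?pos v)"
      using R2 B by (simp add: square)
    then show ?thesis
      using sign[of "?pos u @ [(i, True)]" i "?pos v"] B len by (simp add: square)
  next
    case flat
    then show ?thesis using lower B assms(6) by blast
  next
    case (top x y)
    then show ?thesis using assms(7)[of "?pos x" "?pos y"] B lower by simp
  qed
  with Q show ?case by simp
qed

section \<open>The Homfly-Pt recursion for closed braids\<close>

lemma boundary_append: "boundary (D @ D') st = Option.bind (boundary D st) (boundary D')"
proof (induction D arbitrary: st)
  case (Cons e D)
  then show ?case by (cases "pass e st") simp_all
qed simp

text \<open>The orientations between the cups and the caps of a closure: \<open>k\<close> strands
  going up, then \<open>k\<close> closing strands coming down.\<close>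

definition up_down :: "nat \<Rightarrow> bool list" where
  "up_down k = replicate k True @ replicate k False"

text \<open>The middle part is arbitrary because the proofs pass through diagrams that are not
  braids, such as a braid with a kink.\<close>

definition closed_up :: "nat \<Rightarrow> diagram \<Rightarrow> diagram" where
  "closed_up k X = map (\<lambda>i. (i, Cup True)) [0..<k] @ X @ map (\<lambda>i. (i, Cap)) (rev [0..<k])"

definition braid_diagram :: "braid \<Rightarrow> diagram" where
  "braid_diagram b = map (\<lambda>(i, s). (i - 1, Cross s)) b"

lemma braid_closure_eq: "braid_closure k b = closed_up k (braid_diagram b)"
  by (simp add: braid_closure_def closed_up_def braid_diagram_def)

lemma braid_diagram_simps [simp]:
  "braid_diagram [] = []"
  "braid_diagram ((i, s) # b) = (i - 1, Cross s) # braid_diagram b"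
  "braid_diagram (b @ c) = braid_diagram b @ braid_diagram c"
  by (simp_all add: braid_diagram_def)

text \<open>The last cup and the first cap are the innermost ones and close up the last strand, so a
  partial closure can be split off.\<close>

lemma closed_up_Suc: "closed_up (Suc k) X = closed_up k ([(k, Cup True)] @ X @ [(k, Cap)])"
  by (simp add: closed_up_def)

lemma pass_cup_up_down: "pass (k, Cup True) (up_down k) = Some (up_down (Suc k))"
  by (simp add: up_down_def replicate_append_same)

lemma pass_cap_up_down: "pass (k, Cap) (up_down (Suc k)) = Some (up_down k)"
proof -
  have "up_down (Suc k) = replicate k True @ [True, False] @ replicate k False"
    by (simp add: up_down_def replicate_append_same)
  then show ?thesis by (simp add: up_down_def nth_append)
qed

lemma pass_cross_up_down:
  assumes "Suc i < k"
  shows "pass (i, Cross s) (up_down k) = Some (up_down k)"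
proof -
  have nth: "up_down k ! i = True" "up_down k ! Suc i = True" and len: "Suc i < length (up_down k)"
    using assms by (simp_all add: up_down_def nth_append)
  have "up_down k = take i (up_down k) @ up_down k ! i # up_down k ! Suc i # drop (i + 2) (up_down k)"
    using len by (simp add: Cons_nth_drop_Suc)
  with nth len show ?thesis by simp
qed

lemma boundary_cups: "boundary (map (\<lambda>i. (i, Cup True)) [0..<k]) [] = Some (up_down k)"
proof (induction k)
  case (Suc k)
  then show ?case by (simp add: boundary_append pass_cup_up_down del: pass.simps)
qed (simp add: up_down_def)

lemma boundary_caps: "boundary (map (\<lambda>i. (i, Cap)) (rev [0..<k])) (up_down k) = Some []"
proof (induction k)
  case (Suc k)
  then show ?case by (simp add: pass_cap_up_down del: pass.simps)
qed (simp add: up_down_def)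

lemma link_diagram_closed_up:
  assumes "boundary X (up_down k) = Some (up_down k)"
  shows "link_diagram (closed_up k X)"
  using assms
  by (simp add: link_diagram_def closed_up_def boundary_append boundary_cups boundary_caps)

lemma boundary_braid_diagram:
  "is_braid k b \<Longrightarrow> boundary (braid_diagram b) (up_down k) = Some (up_down k)"
proof (induction b)
  case (Cons g b)
  obtain i s where g: "g = (i, s)" by fastforce
  from Cons.prems have "Suc (i - 1) < k" and b: "is_braid k b"
    by (auto simp: g is_braid_def)
  then show ?case using Cons.IH[OF b] by (simp add: g pass_cross_up_down del: pass.simps)
qed simp

section \<open>Consequences of the framed Homfly-Pt rules\<close>

context
  fixes q a :: "'f::field" and H :: "diagram \<Rightarrow> 'f"
  assumes homfly: "framed_homfly q a H"
begin

lemmas homfly_rules = homfly[unfolded framed_homfly_def]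
lemmas homfly_isotopic = homfly_rules[THEN conjunct1, rule_format]
lemmas homfly_skein_rule = homfly_rules[THEN conjunct2, THEN conjunct1, rule_format]
lemmas homfly_kink_rule = homfly_rules[THEN conjunct2, THEN conjunct2, THEN conjunct1, rule_format]
lemmas homfly_unknot = homfly_rules[THEN conjunct2, THEN conjunct2, THEN conjunct2, rule_format]

lemma homfly_local_move:
  assumes "local_move A B" "link_diagram (U @ A @ V)" "link_diagram (U @ B @ V)"
  shows "H (U @ A @ V) = H (U @ B @ V)"
proof -
  have "framed_isotopic (U @ A @ V) (U @ B @ V)"
    unfolding framed_isotopic_def using assms by (intro r_into_equivclp diagram_move.intros)
  with assms(2) show ?thesis by (intro homfly_isotopic conjI)
qed

lemma homfly_skein:
  assumes "link_diagram (U @ [(i, Cross s)] @ V)" "boundary U [] = Some st" "st ! i = st ! Suc i"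
  shows "H (U @ [(i, Cross True)] @ V) - H (U @ [(i, Cross False)] @ V) = (inverse q - q) * H (U @ V)"
  using homfly_skein_rule[of U i s V st "st ! i" "st ! Suc i"] assms
  by (simp add: oriented_smoothing_def)

lemma homfly_kink:
  assumes "link_diagram (U @ kink_right i d s @ V)"
  shows "H (U @ kink_right i d s @ V) = (if s then inverse a else a) * H (U @ V)"
  by (rule homfly_kink_rule) (use assms in blast)

lemma homfly_closed_up_move:
  assumes "local_move A B"
    and "boundary (X @ A @ Y) (up_down k) = Some (up_down k)"
    and "boundary (X @ B @ Y) (up_down k) = Some (up_down k)"
  shows "H (closed_up k (X @ A @ Y)) = H (closed_up k (X @ B @ Y))"
  using homfly_local_move[OF assms(1), of "map (\<lambda>i. (i, Cup True)) [0..<k] @ X"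
      "Y @ map (\<lambda>i. (i, Cap)) (rev [0..<k])"]
    link_diagram_closed_up[OF assms(2)] link_diagram_closed_up[OF assms(3)]
  by (simp add: closed_up_def)

lemma homfly_closed_up_skein:
  assumes "boundary X (up_down k) = Some st" "boundary ((i, Cross True) # Y) st = Some (up_down k)"
    and "st ! i = st ! Suc i"
  shows "H (closed_up k (X @ (i, Cross True) # Y)) - H (closed_up k (X @ (i, Cross False) # Y)) =
    (inverse q - q) * H (closed_up k (X @ Y))"
proof -
  have "link_diagram (closed_up k (X @ (i, Cross True) # Y))"
    using assms by (intro link_diagram_closed_up) (simp add: boundary_append)
  then show ?thesis
    using homfly_skein[of "map (\<lambda>i. (i, Cup True)) [0..<k] @ X" i True
        "Y @ map (\<lambda>i. (i, Cap)) (rev [0..<k])" st] assms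
    by (simp add: closed_up_def boundary_append boundary_cups)
qed

lemma homfly_closed_up_kink:
  assumes "boundary (X @ kink_right i d s @ Y) (up_down k) = Some (up_down k)"
  shows "H (closed_up k (X @ kink_right i d s @ Y)) = (if s then inverse a else a) * H (closed_up k (X @ Y))"
  using homfly_kink[of "map (\<lambda>i. (i, Cup True)) [0..<k] @ X" i d s
      "Y @ map (\<lambda>i. (i, Cap)) (rev [0..<k])"] link_diagram_closed_up[OF assms]
  by (simp add: closed_up_def)

text \<open>The cup lies to the right of every crossing of \<open>x\<close>, so it passes them one
  by one by \<open>interchange\<close>.\<close>

lemma homfly_slide_cup:
  assumes "is_braid k x" "boundary X (up_down k) = Some (up_down k)"
    and "boundary Y (up_down (Suc k)) = Some (up_down k)"
  shows "H (closed_up k (X @ [(k, Cup True)] @ braid_diagram x @ Y)) =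
    H (closed_up k (X @ braid_diagram x @ [(k, Cup True)] @ Y))"
  using assms
proof (induction x arbitrary: X)
  case (Cons g x)
  obtain i s where g: "g = (i, s)" by fastforce
  from Cons.prems have i: "Suc (i - 1) < k" and x: "is_braid k x"
    by (auto simp: g is_braid_def)
  have B: "boundary (braid_diagram x) (up_down (Suc k)) = Some (up_down (Suc k))"
    using x by (intro boundary_braid_diagram) (auto simp: is_braid_def)
  \<comment> \<open>The crossing occupies positions \<open>i - 1\<close> and \<open>i\<close>, which
    leaves \<open>k - (i + 1)\<close> strands between it and the cup at position
    \<open>k\<close>.\<close>
  have "local_move [(i - 1 + strands_in (Cross s) + (k - (i + 1)), Cup True), (i - 1, Cross s)]
     [(i - 1, Cross s), (i - 1 + strands_out (Cross s) + (k - (i + 1)), Cup True)]"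
    by (rule local_move.interchange)
  moreover have "i - 1 + 2 + (k - (i + 1)) = k"
    using Cons.prems by (simp add: g is_braid_def)
  ultimately have "local_move [(k, Cup True), (i - 1, Cross s)] [(i - 1, Cross s), (k, Cup True)]"
    by simp
  then have "H (closed_up k (X @ [(k, Cup True), (i - 1, Cross s)] @ braid_diagram x @ Y)) =
    H (closed_up k (X @ [(i - 1, Cross s), (k, Cup True)] @ braid_diagram x @ Y))"
    using Cons.prems i B
    by (intro homfly_closed_up_move)
      (simp_all add: boundary_append pass_cross_up_down pass_cup_up_down del: pass.simps)
  also have "\<dots> = H (closed_up k ((X @ [(i - 1, Cross s)]) @ [(k, Cup True)] @ braid_diagram x @ Y))"
    by simp
  also have "\<dots> = H (closed_up k ((X @ [(i - 1, Cross s)]) @ braid_diagram x @ [(k, Cup True)] @ Y))"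
    using Cons.prems i x
    by (intro Cons.IH) (simp_all add: boundary_append pass_cross_up_down del: pass.simps)
  finally show ?case by (simp add: g)
qed simp

lemma homfly_slide_cap:
  assumes "is_braid k y" "boundary X (up_down k) = Some (up_down (Suc k))"
    and "boundary Y (up_down k) = Some (up_down k)"
  shows "H (closed_up k (X @ braid_diagram y @ [(k, Cap)] @ Y)) =
    H (closed_up k (X @ [(k, Cap)] @ braid_diagram y @ Y))"
  using assms
proof (induction y arbitrary: X)
  case (Cons g y)
  obtain i s where g: "g = (i, s)" by fastforce
  from Cons.prems have i: "Suc (i - 1) < k" and y: "is_braid k y"
    by (auto simp: g is_braid_def)
  have B: "boundary (braid_diagram y) (up_down k) = Some (up_down k)"
    by (rule boundary_braid_diagram[OF y])
  have "local_move [(i - 1 + strands_in (Cross s) + (k - (i + 1)), Cap), (i - 1, Cross s)]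
     [(i - 1, Cross s), (i - 1 + strands_out (Cross s) + (k - (i + 1)), Cap)]"
    by (rule local_move.interchange)
  moreover have "i - 1 + 2 + (k - (i + 1)) = k"
    using Cons.prems by (simp add: g is_braid_def)
  ultimately have move: "local_move [(k, Cap), (i - 1, Cross s)] [(i - 1, Cross s), (k, Cap)]"
    by simp
  have "H (closed_up k (X @ braid_diagram (g # y) @ [(k, Cap)] @ Y)) =
     H (closed_up k ((X @ [(i - 1, Cross s)]) @ braid_diagram y @ [(k, Cap)] @ Y))"
    by (simp add: g)
  also have "\<dots> = H (closed_up k ((X @ [(i - 1, Cross s)]) @ [(k, Cap)] @ braid_diagram y @ Y))"
    using Cons.prems i y
    by (intro Cons.IH) (simp_all add: boundary_append pass_cross_up_down del: pass.simps)
  also have "\<dots> = H (closed_up k (X @ [(i - 1, Cross s), (k, Cap)] @ braid_diagram y @ Y))"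
    by simp
  also have "\<dots> = H (closed_up k (X @ [(k, Cap), (i - 1, Cross s)] @ braid_diagram y @ Y))"
    using Cons.prems i B move
    by (intro homfly_closed_up_move[symmetric])
      (simp_all add: boundary_append pass_cross_up_down pass_cap_up_down del: pass.simps)
  finally show ?case by (simp add: g)
qed simp

text \<open>The innermost cup and cap slide towards \<open>M\<close>, past \<open>x\<close> and
  \<open>y\<close>, which do not touch the last strand. A crossing of the last two strands as
  \<open>M\<close> then leaves a kink, an empty \<open>M\<close> a circle.\<close>

lemma homfly_isolate_strand:
  assumes "is_braid k x" "is_braid k y" "boundary M (up_down (Suc k)) = Some (up_down (Suc k))"
  shows "H (closed_up (Suc k) (braid_diagram x @ M @ braid_diagram y)) =
    H (closed_up k (braid_diagram x @ [(k, Cup True)] @ M @ [(k, Cap)] @ braid_diagram y))"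
proof -
  have y: "boundary (braid_diagram y) (up_down (Suc k)) = Some (up_down (Suc k))"
    using assms(2) by (intro boundary_braid_diagram) (auto simp: is_braid_def)
  have "H (closed_up (Suc k) (braid_diagram x @ M @ braid_diagram y)) =
     H (closed_up k ([] @ [(k, Cup True)] @ braid_diagram x @ M @ braid_diagram y @ [(k, Cap)]))"
    by (simp add: closed_up_Suc)
  also have "\<dots> = H (closed_up k ([] @ braid_diagram x @ [(k, Cup True)] @ M @ braid_diagram y @ [(k, Cap)]))"
    using assms y
    by (intro homfly_slide_cup) (simp_all add: boundary_append pass_cap_up_down del: pass.simps)
  also have "\<dots> = H (closed_up k ((braid_diagram x @ [(k, Cup True)] @ M) @ braid_diagram y @ [(k, Cap)] @ []))"
    by simp
  also have "\<dots> = H (closed_up k ((braid_diagram x @ [(k, Cup True)] @ M) @ [(k, Cap)] @ braid_diagram y @ []))"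
    using assms boundary_braid_diagram[OF assms(1)]
    by (intro homfly_slide_cap)
      (simp_all add: boundary_append pass_cup_up_down del: pass.simps)
  finally show ?thesis by simp
qed

text \<open>After isolation, the crossing between the innermost cup and cap is literally a positive
  right kink on the strand at position \<open>k - 1\<close>.\<close>

lemma homfly_markov_crossing:
  assumes "1 \<le> k" "is_braid k x" "is_braid k y"
  shows "H (braid_closure (Suc k) (x @ (k, True) # y)) = inverse a * H (braid_closure k (x @ y))"
proof -
  let ?K = "kink_right (k - Suc 0) True True"
  have K: "?K = [(k, Cup True), (k - Suc 0, Cross True), (k, Cap)]"
    using assms by (simp add: kink_right_def)
  have cross: "pass (k - Suc 0, Cross True) (up_down (Suc k)) = Some (up_down (Suc k))"
    using assms by (simp add: pass_cross_up_down del: pass.simps)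
  have "H (braid_closure (Suc k) (x @ (k, True) # y)) =
    H (closed_up (Suc k) (braid_diagram x @ [(k - Suc 0, Cross True)] @ braid_diagram y))"
    by (simp add: braid_closure_eq)
  also have "\<dots> = H (closed_up k (braid_diagram x @ ?K @ braid_diagram y))"
    using homfly_isolate_strand[OF assms(2,3), of "[(k - Suc 0, Cross True)]"] cross
    by (simp add: K del: pass.simps)
  also have "\<dots> = inverse a * H (closed_up k (braid_diagram x @ braid_diagram y))"
  proof -
    have "boundary (braid_diagram x @ ?K @ braid_diagram y) (up_down k) = Some (up_down k)"
      using assms cross by (simp add: K boundary_append boundary_braid_diagram pass_cup_up_down
          pass_cap_up_down del: pass.simps)
    from homfly_closed_up_kink[OF this] show ?thesis by simp
  qed
  finally show ?thesis by (simp add: braid_closure_eq)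
qed

text \<open>
  The value of a disjoint circle is not among the rules; it follows from the skein rule at the
  crossing of a kink.
\<close>

lemma homfly_markov_circle:
  assumes "1 \<le> k" "is_braid k x" "q \<noteq> inverse q"
  shows "H (braid_closure (Suc k) x) =
    (a - inverse a) / (q - inverse q) * H (braid_closure k x)"
proof -
  let ?K = "\<lambda>s. kink_right (k - Suc 0) True s" and ?x = "braid_diagram x"
  have K: "?K s = [(k, Cup True), (k - Suc 0, Cross s), (k, Cap)]" for s
    using assms by (simp add: kink_right_def)
  have cross: "pass (k - Suc 0, Cross s) (up_down (Suc k)) = Some (up_down (Suc k))" for s
    using assms by (simp add: pass_cross_up_down del: pass.simps)
  have kink: "H (closed_up k (?x @ ?K s)) = (if s then inverse a else a) * H (closed_up k ?x)" for s
    using homfly_closed_up_kink[of ?x "k - Suc 0" True s "[]" k] assms cross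
    by (simp add: K boundary_append boundary_braid_diagram pass_cup_up_down pass_cap_up_down
        del: pass.simps)
  \<comment> \<open>Smoothing the crossing of the kink leaves a cup directly below a cap, which is
    the disjoint circle.\<close>
  have "H (closed_up k ((?x @ [(k, Cup True)]) @ (k - Suc 0, Cross True) # [(k, Cap)])) -
      H (closed_up k ((?x @ [(k, Cup True)]) @ (k - Suc 0, Cross False) # [(k, Cap)])) =
    (inverse q - q) * H (closed_up k ((?x @ [(k, Cup True)]) @ [(k, Cap)]))"
  proof (rule homfly_closed_up_skein)
    show "boundary (?x @ [(k, Cup True)]) (up_down k) = Some (up_down (Suc k))"
      using assms by (simp add: boundary_append boundary_braid_diagram pass_cup_up_down del: pass.simps)
    show "boundary [(k - Suc 0, Cross True), (k, Cap)] (up_down (Suc k)) = Some (up_down k)"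
      using cross by (simp add: pass_cap_up_down del: pass.simps)
    show "up_down (Suc k) ! (k - Suc 0) = up_down (Suc k) ! Suc (k - Suc 0)"
      using assms by (simp add: up_down_def nth_append del: replicate_Suc)
  qed
  moreover have "H (closed_up k ((?x @ [(k, Cup True)]) @ [(k, Cap)])) = H (braid_closure (Suc k) x)"
    using homfly_isolate_strand[OF assms(2), of "[]" "[]"] by (simp add: braid_closure_eq)
  ultimately have "(inverse a - a) * H (closed_up k ?x) =
      (inverse q - q) * H (braid_closure (Suc k) x)"
    using kink[of True] kink[of False] by (simp add: K left_diff_distrib)
  moreover have "inverse q - q \<noteq> 0"
    using assms(3) by simp
  ultimately have "H (braid_closure (Suc k) x) =
      (inverse a - a) / (inverse q - q) * H (closed_up k ?x)"
    by (simp add: field_simps)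
  also have "(inverse a - a) / (inverse q - q) = (a - inverse a) / (q - inverse q)"
    by (metis minus_diff_eq minus_divide_divide)
  finally show ?thesis by (simp add: braid_closure_eq)
qed

section \<open>Skein and braid relations for closures\<close>

lemma homfly_braid_skein:
  assumes "is_braid k (u @ (i, True) # v)"
  shows "H (braid_closure k (u @ (i, True) # v)) - H (braid_closure k (u @ (i, False) # v)) =
    (inverse q - q) * H (braid_closure k (u @ v))"
proof -
  have i: "Suc (i - 1) < k" and u: "is_braid k u" and v: "is_braid k v"
    using assms by (auto simp: is_braid_def)
  have "H (closed_up k (braid_diagram u @ (i - 1, Cross True) # braid_diagram v)) -
      H (closed_up k (braid_diagram u @ (i - 1, Cross False) # braid_diagram v)) =
    (inverse q - q) * H (closed_up k (braid_diagram u @ braid_diagram v))"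
  proof (rule homfly_closed_up_skein[OF boundary_braid_diagram[OF u]])
    show "boundary ((i - 1, Cross True) # braid_diagram v) (up_down k) = Some (up_down k)"
      using boundary_braid_diagram[OF v] i by (simp add: pass_cross_up_down del: pass.simps)
    show "up_down k ! (i - 1) = up_down k ! Suc (i - 1)"
      using i by (simp add: up_down_def nth_append)
  qed
  then show ?thesis by (simp add: braid_closure_eq)
qed

lemma homfly_braid_move:
  assumes "local_move (braid_diagram x) (braid_diagram y)"
    and "is_braid k (u @ x @ v)" "is_braid k (u @ y @ v)"
  shows "H (braid_closure k (u @ x @ v)) = H (braid_closure k (u @ y @ v))"
  using homfly_closed_up_move[OF assms(1), of "braid_diagram u" "braid_diagram v" k]
    boundary_braid_diagram[OF assms(2)] boundary_braid_diagram[OF assms(3)]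
  by (simp add: braid_closure_eq)

lemma homfly_braid_far:
  assumes "is_braid k (u @ [(i, s), (j, t)] @ v)" "Suc i < j"
  shows "H (braid_closure k (u @ [(i, s), (j, t)] @ v)) = H (braid_closure k (u @ [(j, t), (i, s)] @ v))"
proof -
  have "1 \<le> i" using assms by (simp add: is_braid_def)
  \<comment> \<open>A crossing sits at a position one less than the index of its generator;
    \<open>d\<close> counts the strands between the two crossings.\<close>
  define i' d where "i' = i - 1" and "d = j - (i + 2)"
  have "i = Suc i'" "j = Suc (i' + 2 + d)"
    using assms(2) \<open>1 \<le> i\<close> by (simp_all add: i'_def d_def)
  with local_move.interchange[of i' "Cross s" d "Cross t"]
  have "local_move (braid_diagram [(j, t), (i, s)]) (braid_diagram [(i, s), (j, t)])"
    by simp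
  then show ?thesis
    using assms by (intro homfly_braid_move[symmetric]) (auto simp: is_braid_def)
qed

lemma homfly_braid_R2:
  assumes "is_braid k (u @ [(i, True), (i, False)] @ v)"
  shows "H (braid_closure k (u @ [(i, True), (i, False)] @ v)) = H (braid_closure k (u @ v))"
  using homfly_braid_move[of "[(i, True), (i, False)]" "[]" k u v] local_move.R2[of "i - 1" True] assms
  by (simp add: is_braid_def)

lemma homfly_braid_R3:
  assumes "is_braid k (u @ [(i, True), (Suc i, True), (i, True)] @ v)"
  shows "H (braid_closure k (u @ [(i, True), (Suc i, True), (i, True)] @ v)) =
    H (braid_closure k (u @ [(Suc i, True), (i, True), (Suc i, True)] @ v))"
proof -
  have "i - 1 + 1 = i" using assms by (simp add: is_braid_def)
  with local_move.R3[of True True True "i - 1"]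
  have "local_move (braid_diagram [(i, True), (Suc i, True), (i, True)])
      (braid_diagram [(Suc i, True), (i, True), (Suc i, True)])"
    by simp
  then show ?thesis
    using assms by (intro homfly_braid_move) (auto simp: is_braid_def)
qed

end

section \<open>Modules over the doubled Schur algebra\<close>

lemma foldr_commute:
  "(\<And>x v. x \<in> set xs \<Longrightarrow> g (h x v) = h x (g v)) \<Longrightarrow> g (foldr h xs v) = foldr h xs (g v)"
  by (induction xs) simp_all

text \<open>The properties of the base field that enter. \<open>q\<^sup>2 \<noteq> 1\<close> makes
  \<open>q - q\<^sup>-\<^sup>1\<close> invertible; \<open>q\<^sup>2 \<noteq> -1\<close> makes
  \<open>[2]\<close> invertible, which is needed for a division in the braid relation.\<close>

locale quantum_power =
  fixes qp :: "'w::ring_char_0 \<Rightarrow> 'f::field"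
  assumes qp_add: "qp (x + y) = qp x * qp y"
    and qp_nonzero: "qp x \<noteq> 0"
    and q_square: "qp 1 * qp 1 \<noteq> 1" "qp 1 * qp 1 \<noteq> - 1"
begin

abbreviation q :: 'f where "q \<equiv> qp 1"

lemma qp_0: "qp 0 = 1"
  using qp_add[of 0 0] qp_nonzero[of 0] by simp

lemma qp_minus: "qp (- x) = inverse (qp x)"
  using qp_add[of x "- x"] by (simp add: qp_0 inverse_unique)

lemma qp_diff: "qp (x - y) = qp x / qp y"
  using qp_add[of x "- y"] by (simp add: qp_minus field_simps)

lemma q_diff_inverse: "q - inverse q \<noteq> 0"
  using q_square(1) qp_nonzero[of 1] by (simp add: field_simps)

lemma q_sum_inverse: "q + inverse q \<noteq> 0"
proof
  assume "q + inverse q = 0"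
  then have "q * (q + inverse q) = 0" by simp
  then have "q * q + 1 = 0" using qp_nonzero[of 1] by (simp add: distrib_left)
  with q_square(2) show False by (simp add: eq_neg_iff_add_eq_0)
qed

lemma qbracket_0: "qbracket qp 0 = 0"
  by (simp add: qbracket_def)

lemma qbracket_1: "qbracket qp 1 = 1"
  using q_diff_inverse by (simp add: qbracket_def qp_minus)

lemma qbracket_minus: "qbracket qp (- x) = - qbracket qp x"
  by (simp add: qbracket_def minus_divide_left)

lemma qbracket_2: "qbracket qp 2 = q + inverse q"
proof -
  have "qp 2 = q * q"
    using qp_add[of 1 1] by simp
  then have "qp 2 - qp (- 2) = (q + inverse q) * (q - inverse q)"
    by (simp add: qp_minus algebra_simps)
  with q_diff_inverse show ?thesis
    by (simp add: qbracket_def qp_minus)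
qed

text \<open>Collects the two terms from moving \<open>e j\<close> past \<open>f j\<close> in
  \<open>e_f_braid_other_side\<close> into a factor \<open>[2]\<^sup>2\<close> that can be
  cancelled.\<close>

lemma qbracket_3: "qbracket qp 3 + 1 = (q + inverse q) * (q + inverse q)"
proof -
  have "qp 3 = q * q * q"
    using qp_add[of 1 2] qp_add[of 1 1] by simp
  then have "qp 3 - qp (- 3) = ((q + inverse q) * (q + inverse q) - 1) * (q - inverse q)"
    using qp_nonzero[of 1] by (simp add: qp_minus algebra_simps)
  with q_diff_inverse show ?thesis
    by (simp add: qbracket_def qp_minus)
qed

lemma qbracket_eq: "qbracket qp x = (qp x - inverse (qp x)) / (q - inverse q)"
  by (simp add: qbracket_def qp_minus)

text \<open>The source of the framing factor: at \<open>x = \<beta>\<close> the left side is the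
  partial closure of a positive crossing.\<close>

lemma qbracket_pred:
  "inverse q * qbracket qp x - qbracket qp (x - 1) = inverse (qp x)"
proof -
  have "inverse q * (qp x - inverse (qp x)) - (qp (x - 1) - inverse (qp (x - 1))) =
      inverse (qp x) * (q - inverse q)"
    using qp_nonzero[of 1] qp_nonzero[of x] by (simp add: qp_diff field_simps)
  then have "(inverse q * (qp x - inverse (qp x)) - (qp (x - 1) - inverse (qp (x - 1)))) /
      (q - inverse q) = inverse (qp x)"
    using q_diff_inverse by simp
  then show ?thesis
    by (simp add: qbracket_eq diff_divide_distrib right_diff_distrib)
qed

end

text \<open>The vanishing lemmas below rest on this: lowering an entry \<open>0\<close> on the left,
  or raising an entry \<open>\<beta>\<close> on the right, makes a weight inadmissible.\<close>

lemma minus_one_notin_Nats: "(- 1 :: 'a::ring_char_0) \<notin> \<nat>"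
proof
  assume "(- 1 :: 'a) \<in> \<nat>"
  then obtain m where "(- 1 :: 'a) = of_nat m" by (elim Nats_cases)
  then have "of_nat (Suc m) = (0 :: 'a)"
    by (metis add.right_inverse of_nat_Suc)
  then show False by (simp only: of_nat_eq_0_iff)
qed

text \<open>Written with sums instead of updates, so that the shifts of consecutive letters
  telescope and \<open>shift a a\<close> is the identity.\<close>

definition shift :: "nat \<Rightarrow> nat \<Rightarrow> 'w::ring_1 weight \<Rightarrow> 'w weight" where
  "shift a b \<mu> = (\<lambda>i. \<mu> i + of_bool (i = a) - of_bool (i = b))"

lemma shift_same [simp]: "shift a a \<mu> = \<mu>"
  by (simp add: shift_def)

lemma shift_shift [simp]: "shift a b (shift b c \<mu>) = shift a c \<mu>"
  by (rule ext) (simp add: shift_def algebra_simps)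

lemma shift_shift' [simp]: "shift b c (shift a b \<mu>) = shift a c \<mu>"
  by (rule ext) (simp add: shift_def algebra_simps)

lemma shift_apply:
  "shift a b \<mu> i = \<mu> i + of_bool (i = a) - of_bool (i = b)"
  by (simp add: shift_def)

text \<open>
  The morphisms out of a fixed \<open>1\<^sub>\<nu>\<close>, modulo relations, form a module of the following kind, with
  \<open>wt \<mu>\<close> the space of morphisms ending at \<open>1\<^sub>\<mu>\<close>.
\<close>

locale schur_module = quantum_power qp + vector_space scale
  for qp :: "'w::ring_char_0 \<Rightarrow> 'f::field"
    and scale :: "'f \<Rightarrow> 'v::ab_group_add \<Rightarrow> 'v" (infixr "*s" 75) +
  fixes \<beta> :: 'w and n :: nat and e f :: "nat \<Rightarrow> 'v \<Rightarrow> 'v" and wt :: "'w weight \<Rightarrow> 'v set"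
  assumes e_add: "e i (v + w) = e i v + e i w"
    and e_scale: "e i (c *s v) = c *s e i v"
    and f_add: "f i (v + w) = f i v + f i w"
    and f_scale: "f i (c *s v) = c *s f i v"
    and wt_subspace: "subspace (wt \<mu>)"
    and wt_e: "v \<in> wt \<mu> \<Longrightarrow> e i v \<in> wt (shift i (Suc i) \<mu>)"
    and wt_f: "v \<in> wt \<mu> \<Longrightarrow> f i v \<in> wt (shift (Suc i) i \<mu>)"
    and wt_inadmissible: "v \<in> wt \<mu> \<Longrightarrow> \<not> admissible \<beta> n n \<mu> \<Longrightarrow> v = 0"
    and ef_same: "i \<in> {1..<n+n} \<Longrightarrow> v \<in> wt \<mu> \<Longrightarrow>
      e i (f i v) = f i (e i v) + qbracket qp (\<mu> i - \<mu> (Suc i)) *s v"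
    and ef_distinct: "i \<in> {1..<n+n} \<Longrightarrow> j \<in> {1..<n+n} \<Longrightarrow> i \<noteq> j \<Longrightarrow> e i (f j v) = f j (e i v)"
    and serre_e: "i \<in> {1..<n+n} \<Longrightarrow> j \<in> {1..<n+n} \<Longrightarrow> j = Suc i \<or> i = Suc j \<Longrightarrow>
      e i (e i (e j v)) + e j (e i (e i v)) = (q + inverse q) *s e i (e j (e i v))"
    and serre_f: "i \<in> {1..<n+n} \<Longrightarrow> j \<in> {1..<n+n} \<Longrightarrow> j = Suc i \<or> i = Suc j \<Longrightarrow>
      f i (f i (f j v)) + f j (f i (f i v)) = (q + inverse q) *s f i (f j (f i v))"
    and e_far: "i \<in> {1..<n+n} \<Longrightarrow> j \<in> {1..<n+n} \<Longrightarrow> Suc i < j \<or> Suc j < i \<Longrightarrow>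
      e i (e j v) = e j (e i v)"
    and f_far: "i \<in> {1..<n+n} \<Longrightarrow> j \<in> {1..<n+n} \<Longrightarrow> Suc i < j \<or> Suc j < i \<Longrightarrow>
      f i (f j v) = f j (f i v)"
begin

section \<open>Vanishing and rank-one computations\<close>

lemma e_0 [simp]: "e i 0 = 0"
  using e_scale[of i 0 0] by simp

lemma f_0 [simp]: "f i 0 = 0"
  using f_scale[of i 0 0] by simp

lemma e_minus: "e i (- v) = - e i v"
  using e_add[of i v "- v"] by (simp add: minus_unique)

lemma f_minus: "f i (- v) = - f i v"
  using f_add[of i v "- v"] by (simp add: minus_unique)

lemma e_diff: "e i (v - w) = e i v - e i w"
  using e_add[of i v "- w"] by (simp add: e_minus)

lemma f_diff: "f i (v - w) = f i v - f i w"
  using f_add[of i v "- w"] by (simp add: f_minus)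

lemmas ef_linear = e_add f_add e_scale f_scale e_diff f_diff

lemma f_eq_0_left:
  assumes "v \<in> wt \<mu>" "i \<in> {1..n}" "\<mu> i = 0"
  shows "f i v = 0"
proof (rule wt_inadmissible[OF wt_f[OF assms(1)]])
  have "shift (Suc i) i \<mu> i \<notin> \<nat>"
    using assms by (simp add: shift_apply minus_one_notin_Nats)
  then show "\<not> admissible \<beta> n n (shift (Suc i) i \<mu>)"
    using assms(2) unfolding admissible_def by blast
qed

lemma e_eq_0_left:
  assumes "v \<in> wt \<mu>" "Suc i \<in> {1..n}" "\<mu> (Suc i) = 0"
  shows "e i v = 0"
proof (rule wt_inadmissible[OF wt_e[OF assms(1)]])
  have "shift i (Suc i) \<mu> (Suc i) \<notin> \<nat>"
    using assms by (simp add: shift_apply minus_one_notin_Nats)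
  then show "\<not> admissible \<beta> n n (shift i (Suc i) \<mu>)"
    using assms(2) unfolding admissible_def by blast
qed

lemma f_eq_0_right:
  assumes "v \<in> wt \<mu>" "Suc i \<in> {n+1..n+n}" "\<mu> (Suc i) = \<beta>"
  shows "f i v = 0"
proof (rule wt_inadmissible[OF wt_f[OF assms(1)]])
  have "\<beta> - shift (Suc i) i \<mu> (Suc i) \<notin> \<nat>"
    using assms by (simp add: shift_apply minus_one_notin_Nats)
  then show "\<not> admissible \<beta> n n (shift (Suc i) i \<mu>)"
    using assms(2) unfolding admissible_def by blast
qed

text \<open>On a vector killed by \<open>f i\<close>, the commutator relation leaves only a scalar
  read off from the weight.\<close>

lemma f_e_eq:
  assumes "v \<in> wt \<mu>" "i \<in> {1..<n+n}" "f i v = 0"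
  shows "f i (e i v) = qbracket qp (\<mu> (Suc i) - \<mu> i) *s v"
proof -
  have "f i (e i v) = - (qbracket qp (\<mu> i - \<mu> (Suc i)) *s v)"
    using ef_same[OF assms(2,1)] assms(3) by (simp add: eq_neg_iff_add_eq_0)
  also have "\<dots> = qbracket qp (- (\<mu> i - \<mu> (Suc i))) *s v"
    by (simp only: qbracket_minus scale_minus_left)
  finally show ?thesis by simp
qed

lemma e_f_eq:
  assumes "v \<in> wt \<mu>" "i \<in> {1..<n+n}" "e i v = 0"
  shows "e i (f i v) = qbracket qp (\<mu> i - \<mu> (Suc i)) *s v"
  using ef_same[OF assms(2,1)] assms(3) by simp

section \<open>Ladders of letters\<close>

lemma wt_e_ladder:
  assumes "v \<in> wt \<mu>" "a \<le> b"
  shows "foldr e [a..<b] v \<in> wt (shift a b \<mu>)"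
  using assms(2,1)
proof (induction b arbitrary: v \<mu> rule: dec_induct)
  case (step b)
  from step.IH[OF wt_e[OF step.prems, of b]] step.hyps show ?case by simp
qed simp

lemma wt_e_ladder_rev:
  assumes "v \<in> wt \<mu>" "a \<le> b"
  shows "foldr e (rev [a..<b]) v \<in> wt (shift a b \<mu>)"
  using assms(2,1)
proof (induction b rule: dec_induct)
  case (step b)
  from wt_e[OF step.IH[OF step.prems], of b] step.hyps show ?case by simp
qed simp

text \<open>The letters \<open>e\<close> carry a unit from position \<open>b\<close> down to
  \<open>a\<close> through zeros, and the letters \<open>f\<close> carry it back. Each pair meets
  the entries 0 and 1 and contributes \<open>[1] = 1\<close>.\<close>

lemma f_e_ladder_left:
  assumes "v \<in> wt \<mu>" "1 \<le> a" "a \<le> b" "b \<le> n" "\<And>i. i \<in> {a..<b} \<Longrightarrow> \<mu> i = 0" "\<mu> b = 1"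
  shows "foldr f (rev [a..<b]) (foldr e [a..<b] v) = v"
  using assms(3,1,2,4-)
proof (induction b arbitrary: v \<mu> rule: dec_induct)
  case (step b)
  have "foldr f (rev [a..<b]) (foldr e [a..<b] (e b v)) = e b v"
    using step.hyps step.prems by (intro step.IH[OF wt_e[OF step.prems(1)]]) (auto simp: shift_apply)
  moreover have "f b v = 0"
    using step.hyps step.prems by (intro f_eq_0_left[of v \<mu>]) auto
  then have "f b (e b v) = v"
    using step.hyps step.prems f_e_eq[of v \<mu> b] by (simp add: qbracket_1)
  ultimately show ?case using step.hyps by simp
qed simp

text \<open>Mirror image: the entry \<open>\<beta> - 1\<close> travels from \<open>a\<close> to
  \<open>b\<close> through entries \<open>\<beta>\<close> and back, again with a factor
  \<open>[1]\<close> per pair.\<close>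

lemma f_e_ladder_right:
  assumes "v \<in> wt \<mu>" "n < a" "a \<le> b" "b \<le> n + n" "\<mu> a = \<beta> - 1"
    "\<And>i. i \<in> {a<..b} \<Longrightarrow> \<mu> i = \<beta>"
  shows "foldr f [a..<b] (foldr e (rev [a..<b]) v) = v"
  using assms(3,1,2,4-)
proof (induction a arbitrary: v \<mu> rule: inc_induct)
  case (step a)
  have "foldr f [Suc a..<b] (foldr e (rev [Suc a..<b]) (e a v)) = e a v"
    using step.hyps step.prems by (intro step.IH[OF wt_e[OF step.prems(1)]]) (auto simp: shift_apply)
  moreover have "f a v = 0"
    using step.hyps step.prems by (intro f_eq_0_right[of v \<mu>]) auto
  then have "f a (e a v) = v"
    using step.hyps step.prems f_e_eq[of v \<mu> a] by (simp add: qbracket_1)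
  ultimately show ?case using step.hyps by (simp add: upt_conv_Cons)
qed simp

text \<open>The outer pair \<open>e p\<close>, \<open>f p\<close> is moved to the outside of the
  ladder, which turns the problem for \<open>p\<close> and \<open>v\<close> into the one for
  \<open>Suc p\<close> and \<open>f p v\<close>. Afterwards \<open>e p (f p v) = v\<close>, because
  \<open>e p v = 0\<close>.\<close>

lemma f_e_ladder_crossing:
  assumes "v \<in> wt \<mu>" "1 \<le> p" "p < n" "\<mu> p = 1" "\<And>i. i \<in> {p<..n} \<Longrightarrow> \<mu> i = 0" "\<mu> (Suc n) = \<beta>"
  shows "foldr f (rev [Suc p..<Suc n]) (e p (f p (foldr e [Suc p..<Suc n] v))) =
    qbracket qp (\<beta> - 1) *s v"
proof -
  have "p \<le> n - 1" using assms(3) by simp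
  then show ?thesis using assms
  proof (induction p arbitrary: v \<mu> rule: inc_induct)
    case base
    let ?p = "n - 1"
    have p: "Suc ?p = n" using base.prems by simp
    have range: "?p \<in> {1..<n+n}" "n \<in> {1..<n+n}" "?p \<noteq> n"
      using base.prems by auto
    have \<mu>: "\<mu> n = 0" using base.prems by simp
    have "foldr f (rev [Suc ?p..<Suc n]) (e ?p (f ?p (foldr e [Suc ?p..<Suc n] v))) =
       f n (e ?p (f ?p (e n v)))"
      using p by simp
    also have "\<dots> = f n (e ?p (e n (f ?p v)))"
      by (simp only: ef_distinct[OF range(2,1) range(3)[symmetric]])
    also have "\<dots> = e ?p (f n (e n (f ?p v)))"
      by (simp only: ef_distinct[OF range])
    \<comment> \<open>\<open>f ?p v\<close> has entry 1 at position \<open>n\<close> in place of 0,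
      so the bracket is \<open>[\<beta> - 1]\<close> and not \<open>[\<beta>]\<close>.\<close>
    also have "f n (e n (f ?p v)) = qbracket qp (\<beta> - 1) *s f ?p v"
    proof -
      have w: "f ?p v \<in> wt (shift n ?p \<mu>)"
        using wt_f[OF base.prems(1), of ?p] p by simp
      have "f n (f ?p v) = 0"
        using base.prems p by (intro f_eq_0_right[OF w]) (auto simp: shift_apply)
      then show ?thesis
        using f_e_eq[OF w range(2)] range(3)[symmetric] base.prems p \<mu> by (auto simp: shift_apply)
    qed
    also have "e ?p (qbracket qp (\<beta> - 1) *s f ?p v) = qbracket qp (\<beta> - 1) *s v"
    proof -
      have "e ?p v = 0"
        using base.prems p \<mu> by (intro e_eq_0_left[OF base.prems(1)]) auto
      then show ?thesis
        using e_f_eq[OF base.prems(1), of ?p] base.prems p \<mu> by (simp add: e_scale qbracket_1)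
    qed
    finally show ?case .
  next
    case (step p)
    let ?x = "foldr e [Suc (Suc p)..<Suc n]" and ?y = "foldr f (rev [Suc (Suc p)..<Suc n])"
    have upt: "[Suc p..<Suc n] = Suc p # [Suc (Suc p)..<Suc n]"
      using step.hyps by (simp add: upt_conv_Cons)
    have fx: "f p (?x w) = ?x (f p w)" for w
      by (intro foldr_commute) (use step.hyps step.prems in \<open>auto simp: ef_distinct\<close>)
    have ey: "e p (?y w) = ?y (e p w)" for w
      by (intro foldr_commute) (use step.hyps step.prems in \<open>auto simp: ef_distinct\<close>)
    have fv: "f p v \<in> wt (shift (Suc p) p \<mu>)"
      by (rule wt_f) fact
    have xw: "?x (f p v) \<in> wt (shift (Suc (Suc p)) (Suc n) (shift (Suc p) p \<mu>))"
      using step.hyps by (intro wt_e_ladder[OF fv]) simp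
    \<comment> \<open>Both entries, at \<open>Suc p\<close> and \<open>Suc (Suc p)\<close>, are 1
      here, so the commutator is \<open>[0] = 0\<close>.\<close>
    have swap: "f (Suc p) (e (Suc p) (?x (f p v))) = e (Suc p) (f (Suc p) (?x (f p v)))"
    proof -
      have "Suc p \<noteq> n" using step.hyps by simp
      then show ?thesis
        using ef_same[OF _ xw, of "Suc p"] step.hyps step.prems
        by (simp add: shift_apply qbracket_0 del: upt_Suc)
    qed
    have "foldr f (rev [Suc p..<Suc n]) (e p (f p (foldr e [Suc p..<Suc n] v))) =
       ?y (f (Suc p) (e p (f p (e (Suc p) (?x v)))))"
      by (simp add: upt del: upt_Suc)
    also have "\<dots> = ?y (e p (f (Suc p) (e (Suc p) (?x (f p v)))))"
      using step.hyps step.prems by (simp add: ef_distinct fx[symmetric] del: upt_Suc)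
    also have "\<dots> = e p (?y (e (Suc p) (f (Suc p) (?x (f p v)))))"
      by (simp only: ey swap)
    also have "\<dots> = e p (qbracket qp (\<beta> - 1) *s f p v)"
    proof -
      have "?y (e (Suc p) (f (Suc p) (?x (f p v)))) = qbracket qp (\<beta> - 1) *s f p v"
        using step.hyps step.prems by (intro step.IH[OF fv]) (auto simp: shift_apply)
      then show ?thesis by simp
    qed
    also have "\<dots> = qbracket qp (\<beta> - 1) *s v"
    proof -
      have "e p v = 0"
        using step.hyps step.prems by (intro e_eq_0_left[of v \<mu>]) auto
      then show ?thesis
        using e_f_eq[of v \<mu> p] step.hyps step.prems by (simp add: e_scale qbracket_1)
    qed
    finally show ?case .
  qed
qed

section \<open>Cups, caps and partial closures\<close>

definition cup :: "nat \<Rightarrow> 'v \<Rightarrow> 'v" where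
  "cup k v = foldr e [Suc k..<n] (foldr e (rev [Suc n..<n+n-k]) (e n v))"

text \<open>\<open>cup k\<close> and \<open>cap k\<close> are
  \<open>D\<^sub>n\<^sub>-\<^sub>k\<^sup>*\<close> and \<open>D\<^sub>n\<^sub>-\<^sub>k\<close>: the
  argument is the number of strands outside the new arc.\<close>

definition cap :: "nat \<Rightarrow> 'v \<Rightarrow> 'v" where
  "cap k v = f n (foldr f [Suc n..<n+n-k] (foldr f (rev [Suc k..<n]) v))"

text \<open>The weight \<open>(1\<^sup>k, 0\<^sup>n\<^sup>-\<^sup>k,
  \<beta>\<^sup>n\<^sup>-\<^sup>k, (\<beta>-1)\<^sup>k)\<close>. The bounds fix the values at 0 and
  beyond \<open>n + n\<close>, so that weights can be compared as functions.\<close>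

definition level_weight :: "nat \<Rightarrow> 'w weight" where
  "level_weight k i = zero_weight \<beta> n i + of_bool (1 \<le> i \<and> i \<le> k) - of_bool (n + n - k < i \<and> i \<le> n + n)"

lemma level_weight_0: "level_weight 0 = zero_weight \<beta> n"
  by (auto simp: level_weight_def)

lemma wt_cup:
  assumes "v \<in> wt (level_weight k)" "k < n"
  shows "cup k v \<in> wt (level_weight (Suc k))"
proof -
  have "cup k v \<in> wt (shift (Suc k) n (shift (Suc n) (n + n - k) (shift n (Suc n) (level_weight k))))"
    unfolding cup_def using assms by (intro wt_e_ladder wt_e_ladder_rev wt_e) simp_all
  also have "shift (Suc k) n (shift (Suc n) (n + n - k) (shift n (Suc n) (level_weight k))) =
    level_weight (Suc k)"
    using assms(2) by (auto simp: fun_eq_iff shift_apply level_weight_def of_bool_def)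
  finally show ?thesis .
qed

text \<open>Both ladders cancel, and \<open>f n (e n v)\<close> remains on entries 0 and
  \<open>\<beta>\<close>.\<close>

lemma cap_cup:
  assumes "v \<in> wt (level_weight k)" "k < n"
  shows "cap k (cup k v) = qbracket qp \<beta> *s v"
proof -
  let ?x = "foldr e (rev [Suc n..<n+n-k]) (e n v)"
  have env: "e n v \<in> wt (shift n (Suc n) (level_weight k))"
    by (rule wt_e[OF assms(1)])
  have x: "?x \<in> wt (shift (Suc n) (n+n-k) (shift n (Suc n) (level_weight k)))"
    using assms by (intro wt_e_ladder_rev env) simp
  have "foldr f (rev [Suc k..<n]) (foldr e [Suc k..<n] ?x) = ?x"
    using assms(2) by (intro f_e_ladder_left[OF x]) (auto simp: shift_apply level_weight_def zero_weight_def)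
  moreover have "foldr f [Suc n..<n+n-k] ?x = e n v"
    using assms(2) by (intro f_e_ladder_right[OF env]) (auto simp: shift_apply level_weight_def zero_weight_def)
  moreover have "f n v = 0"
    using assms(2) by (intro f_eq_0_left[OF assms(1)]) (auto simp: level_weight_def zero_weight_def)
  then have "f n (e n v) = qbracket qp \<beta> *s v"
    using f_e_eq[OF assms(1), of n] assms(2) by (simp add: level_weight_def zero_weight_def)
  ultimately show ?thesis by (simp add: cap_def cup_def)
qed

text \<open>The ladder on the right commutes with everything on the left and cancels; the rest is
  \<open>f_e_ladder_crossing\<close>.\<close>

lemma cap_crossing_cup:
  assumes "v \<in> wt (level_weight k)" "1 \<le> k" "k < n"
  shows "cap k (e k (f k (cup k v))) = qbracket qp (\<beta> - 1) *s v"
proof -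
  let ?g = "foldr f [Suc n..<n+n-k]" and ?x = "foldr e (rev [Suc n..<n+n-k]) (e n v)"
  have env: "e n v \<in> wt (shift n (Suc n) (level_weight k))"
    by (rule wt_e[OF assms(1)])
  have g1: "?g (foldr f (rev [Suc k..<n]) w) = foldr f (rev [Suc k..<n]) (?g w)" for w
    by (intro foldr_commute foldr_commute[symmetric]) (use assms in \<open>auto simp: f_far\<close>)
  have g2: "?g (foldr e [Suc k..<n] w) = foldr e [Suc k..<n] (?g w)" for w
    by (intro foldr_commute foldr_commute[symmetric]) (use assms in \<open>auto simp: ef_distinct\<close>)
  have g3: "?g (e k w) = e k (?g w)" for w
    by (intro foldr_commute[symmetric]) (use assms in \<open>auto simp: ef_distinct\<close>)
  have g4: "?g (f k w) = f k (?g w)" for w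
    by (intro foldr_commute[symmetric]) (use assms in \<open>auto simp: f_far\<close>)
  have "?g ?x = e n v"
    using assms(3) by (intro f_e_ladder_right[OF env]) (auto simp: shift_apply level_weight_def zero_weight_def)
  then have "cap k (e k (f k (cup k v))) =
      f n (foldr f (rev [Suc k..<n]) (e k (f k (foldr e [Suc k..<n] (e n v)))))"
    by (simp add: cap_def cup_def g1 g2 g3 g4)
  \<comment> \<open>The letters \<open>e n\<close> and \<open>f n\<close> become the last rungs of
    the ladders on the left.\<close>
  also have "\<dots> = foldr f (rev [Suc k..<Suc n]) (e k (f k (foldr e [Suc k..<Suc n] v)))"
    using assms(3) by simp
  also have "\<dots> = qbracket qp (\<beta> - 1) *s v"
    using assms(2,3) by (intro f_e_ladder_crossing[OF assms(1)]) (auto simp: level_weight_def zero_weight_def)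
  finally show ?thesis .
qed

text \<open>Every letter of \<open>cup k\<close> has index above \<open>k\<close>, hence at distance
  at least two from \<open>i\<close>.\<close>

lemma e_f_cup_commute:
  assumes "1 \<le> i" "i < k" "k < n"
  shows "e i (f i (cup k v)) = cup k (e i (f i v))"
proof -
  have f1: "f i (foldr e [Suc k..<n] w) = foldr e [Suc k..<n] (f i w)" for w
    by (intro foldr_commute) (use assms in \<open>auto simp: ef_distinct\<close>)
  have f2: "f i (foldr e (rev [Suc n..<n+n-k]) w) = foldr e (rev [Suc n..<n+n-k]) (f i w)" for w
    by (intro foldr_commute) (use assms in \<open>auto simp: ef_distinct\<close>)
  have f3: "f i (e n w) = e n (f i w)" for w
    using assms by (simp add: ef_distinct)
  have e1: "e i (foldr e [Suc k..<n] w) = foldr e [Suc k..<n] (e i w)" for w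
    by (intro foldr_commute) (use assms in \<open>auto simp: e_far\<close>)
  have e2: "e i (foldr e (rev [Suc n..<n+n-k]) w) = foldr e (rev [Suc n..<n+n-k]) (e i w)" for w
    by (intro foldr_commute) (use assms in \<open>auto simp: e_far\<close>)
  have e3: "e i (e n w) = e n (e i w)" for w
    using assms by (simp add: e_far)
  show ?thesis
    by (simp only: cup_def f1 f2 f3 e1 e2 e3)
qed

lemma e_f_cap_commute:
  assumes "1 \<le> i" "i < k" "k < n"
  shows "e i (f i (cap k v)) = cap k (e i (f i v))"
proof -
  have f1: "f i (foldr f (rev [Suc k..<n]) w) = foldr f (rev [Suc k..<n]) (f i w)" for w
    by (intro foldr_commute) (use assms in \<open>auto simp: f_far\<close>)
  have f2: "f i (foldr f [Suc n..<n+n-k] w) = foldr f [Suc n..<n+n-k] (f i w)" for w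
    by (intro foldr_commute) (use assms in \<open>auto simp: f_far\<close>)
  have f3: "f i (f n w) = f n (f i w)" for w
    using assms by (simp add: f_far)
  have e1: "e i (foldr f (rev [Suc k..<n]) w) = foldr f (rev [Suc k..<n]) (e i w)" for w
    by (intro foldr_commute) (use assms in \<open>auto simp: ef_distinct\<close>)
  have e2: "e i (foldr f [Suc n..<n+n-k] w) = foldr f [Suc n..<n+n-k] (e i w)" for w
    by (intro foldr_commute) (use assms in \<open>auto simp: ef_distinct\<close>)
  have e3: "e i (f n w) = f n (e i w)" for w
    using assms by (simp add: ef_distinct)
  show ?thesis
    by (simp only: cap_def f1 f2 f3 e1 e2 e3)
qed

section \<open>Braids acting on weight vectors\<close>

definition crossing :: "nat \<times> bool \<Rightarrow> 'v \<Rightarrow> 'v" where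
  "crossing g v = (if snd g then inverse q else q) *s v - e (fst g) (f (fst g) v)"

text \<open>\<open>fold\<close> and not \<open>foldr\<close>: the bottom crossing stands first in
  the list and acts first.\<close>

definition braid_act :: "braid \<Rightarrow> 'v \<Rightarrow> 'v" where
  "braid_act b = fold crossing b"

lemma braid_act_simps [simp]:
  "braid_act [] v = v"
  "braid_act (g # b) v = braid_act b (crossing g v)"
  "braid_act (b @ c) v = braid_act c (braid_act b v)"
  by (simp_all add: braid_act_def)

lemma crossing_scale: "crossing g (c *s v) = c *s crossing g v"
  by (simp add: crossing_def ef_linear scale_right_diff_distrib scale_left_commute)

lemma crossing_diff: "crossing g (v - w) = crossing g v - crossing g w"
  by (simp add: crossing_def ef_linear scale_right_diff_distrib)

lemma braid_act_scale: "braid_act b (c *s v) = c *s braid_act b v"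
  by (induction b arbitrary: v) (simp_all add: crossing_scale)

lemma braid_act_diff: "braid_act b (v - w) = braid_act b v - braid_act b w"
  by (induction b arbitrary: v w) (simp_all add: crossing_diff)

lemma crossing_skein: "crossing (i, True) v - crossing (i, False) v = (inverse q - q) *s v"
  by (simp add: crossing_def scale_left_diff_distrib)

lemma wt_crossing:
  assumes "v \<in> wt \<mu>"
  shows "crossing g v \<in> wt \<mu>"
proof -
  have "e (fst g) (f (fst g) v) \<in> wt (shift (fst g) (Suc (fst g)) (shift (Suc (fst g)) (fst g) \<mu>))"
    using assms by (intro wt_e wt_f)
  then show ?thesis
    using assms by (simp add: crossing_def subspace_diff subspace_scale wt_subspace)
qed

lemma wt_braid_act: "v \<in> wt \<mu> \<Longrightarrow> braid_act b v \<in> wt \<mu>"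
  by (induction b arbitrary: v) (simp_all add: wt_crossing)

lemma cup_scale: "cup k (c *s v) = c *s cup k v"
proof -
  have "foldr e xs (c *s w) = c *s foldr e xs w" for xs w
    by (induction xs) (simp_all add: e_scale)
  then show ?thesis by (simp only: cup_def e_scale)
qed

lemma cup_diff: "cup k (v - w) = cup k v - cup k w"
proof -
  have "foldr e xs (x - y) = foldr e xs x - foldr e xs y" for xs x y
    by (induction xs) (simp_all add: e_diff)
  then show ?thesis by (simp only: cup_def e_diff)
qed

lemma cap_scale: "cap k (c *s v) = c *s cap k v"
proof -
  have "foldr f xs (c *s w) = c *s foldr f xs w" for xs w
    by (induction xs) (simp_all add: f_scale)
  then show ?thesis by (simp only: cap_def f_scale)
qed

lemma cap_diff: "cap k (v - w) = cap k v - cap k w"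
proof -
  have "foldr f xs (x - y) = foldr f xs x - foldr f xs y" for xs x y
    by (induction xs) (simp_all add: f_diff)
  then show ?thesis by (simp only: cap_def f_diff)
qed

lemma braid_act_cup:
  assumes "is_braid k b" "k < n"
  shows "braid_act b (cup k v) = cup k (braid_act b v)"
  using assms(1)
proof (induction b arbitrary: v)
  case (Cons g b)
  then have "crossing g (cup k v) = cup k (crossing g v)"
    using assms(2) by (auto simp: crossing_def is_braid_def cup_scale cup_diff e_f_cup_commute)
  with Cons show ?case by (simp add: is_braid_def)
qed simp

lemma braid_act_cap:
  assumes "is_braid k b" "k < n"
  shows "braid_act b (cap k v) = cap k (braid_act b v)"
  using assms(1)
proof (induction b arbitrary: v)
  case (Cons g b)
  then have "crossing g (cap k v) = cap k (crossing g v)"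
    using assms(2) by (auto simp: crossing_def is_braid_def cap_scale cap_diff e_f_cap_commute)
  with Cons show ?case by (simp add: is_braid_def)
qed simp

text \<open>\<open>U\<^sup>2 = [2] U\<close> for \<open>U = E\<^sub>iF\<^sub>i\<close>: on
  \<open>f i v\<close> the two entries are 0 and 2, and a second \<open>f i\<close> kills
  it.\<close>

lemma e_f_e_f:
  assumes "v \<in> wt \<mu>" "1 \<le> i" "Suc i \<le> n" "\<mu> i = 1" "\<mu> (Suc i) = 1"
  shows "e i (f i (e i (f i v))) = (q + inverse q) *s e i (f i v)"
proof -
  have fv: "f i v \<in> wt (shift (Suc i) i \<mu>)"
    by (rule wt_f) fact
  have "f i (f i v) = 0"
    using assms by (intro f_eq_0_left[OF fv]) (auto simp: shift_apply)
  then have "f i (e i (f i v)) = (q + inverse q) *s f i v"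
    using f_e_eq[OF fv, of i] assms by (simp add: shift_apply qbracket_2)
  then show ?thesis by (simp add: e_scale)
qed

text \<open>\<open>(q - U)(q\<^sup>-\<^sup>1 - U) = 1 - [2] U + U\<^sup>2 = 1\<close>.\<close>

lemma crossing_R2:
  assumes "v \<in> wt \<mu>" "1 \<le> i" "Suc i \<le> n" "\<mu> i = 1" "\<mu> (Suc i) = 1"
  shows "crossing (i, False) (crossing (i, True) v) = v"
  using qp_nonzero[of 1]
  by (simp add: crossing_def ef_linear e_f_e_f[OF assms] scale_right_diff_distrib scale_left_distrib)

lemma crossing_far:
  assumes "i \<in> {1..<n+n}" "j \<in> {1..<n+n}" "Suc i < j"
  shows "crossing (i, s) (crossing (j, t) v) = crossing (j, t) (crossing (i, s) v)"
proof -
  have "e i (f i (e j (f j v))) = e i (e j (f i (f j v)))"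
    using assms ef_distinct[of j i] by simp
  also have "\<dots> = e j (e i (f j (f i v)))"
    using assms by (simp add: e_far f_far)
  also have "\<dots> = e j (f j (e i (f i v)))"
    using assms by (simp add: ef_distinct)
  finally show ?thesis
    by (simp add: crossing_def ef_linear scale_right_diff_distrib scale_left_commute)
qed

text \<open>Regrouped, the pair \<open>f i\<close>, \<open>e i\<close> acts on
  \<open>f j (f i v)\<close>, whose entries at \<open>i\<close> and \<open>j\<close> are 0 and 1;
  there it is the identity.\<close>

lemma e_f_braid_same_side:
  assumes "v \<in> wt \<mu>" "1 \<le> i" "Suc (Suc i) \<le> n" "\<mu> i = 1" "\<mu> (Suc i) = 1" "\<mu> (Suc (Suc i)) = 1"
  defines "j \<equiv> Suc i"
  shows "e i (f i (e j (f j (e i (f i v))))) = e i (e j (f j (f i v)))"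
proof -
  have fv: "f j (f i v) \<in> wt (shift (Suc j) i \<mu>)"
    using wt_f[OF wt_f[OF assms(1), of i], of j] by (simp add: j_def)
  have "f i (f j (f i v)) = 0"
    using assms(2-6) by (intro f_eq_0_left[OF fv]) (auto simp: shift_apply j_def)
  then have *: "f i (e i (f j (f i v))) = f j (f i v)"
    using f_e_eq[OF fv, of i] assms(2-6) by (simp add: shift_apply j_def qbracket_1)
  have "e i (f i (e j (f j (e i (f i v))))) = e i (e j (f i (e i (f j (f i v)))))"
    using assms(2,3) ef_distinct[of i j] ef_distinct[of j i] by (simp add: j_def)
  with * show ?thesis by simp
qed

text \<open>
  With all three weights equal to \<open>1\<close>, the Serre relations collapse to \<open>F\<^sub>jF\<^sub>iF\<^sub>j = [2]\<^sup>-\<^sup>1 F\<^sub>j\<^sup>2F\<^sub>i\<close> and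
  \<open>E\<^sub>jE\<^sub>iE\<^sub>j = [2]\<^sup>-\<^sup>1 E\<^sub>iE\<^sub>j\<^sup>2\<close>; this brings \<open>E\<^sub>j\<^sup>2F\<^sub>j\<^sup>2\<close> into play, which is computed by moving the
  letters \<open>E\<^sub>j\<close> to the right.
\<close>

lemma e_f_braid_other_side:
  assumes "v \<in> wt \<mu>" "1 \<le> i" "Suc (Suc i) \<le> n" "\<mu> i = 1" "\<mu> (Suc i) = 1" "\<mu> (Suc (Suc i)) = 1"
  defines "j \<equiv> Suc i"
  shows "e j (f j (e i (f i (e j (f j v))))) = e i (e j (f j (f i v))) - e i (f i v) + e j (f j v)"
proof -
  let ?two = "q + inverse q"
  have range: "i \<in> {1..<n+n}" "j \<in> {1..<n+n}" "i \<noteq> j" "j \<noteq> i" "j = Suc i \<or> i = Suc j" "i = Suc j \<or> j = Suc i"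
    using assms(2,3) by (auto simp: j_def)
  have fj: "f j v \<in> wt (shift (Suc j) j \<mu>)"
    by (rule wt_f) fact
  have fij: "f i (f j v) \<in> wt (shift (Suc j) i \<mu>)"
    using wt_f[OF fj, of i] by (simp add: j_def)
  have "e j (f j (e i (f i (e j (f j v))))) = e j (e i (f j (e j (f i (f j v)))))"
    using range ef_distinct[of i j] ef_distinct[of j i] by simp
  \<comment> \<open>The entries at \<open>j\<close> and \<open>Suc j\<close> are now 1 and 2, which
    gives \<open>[-1] = -1\<close>.\<close>
  also have "f j (e j (f i (f j v))) = e j (f j (f i (f j v))) + f i (f j v)"
  proof -
    have "qbracket qp (shift (Suc j) i \<mu> j - shift (Suc j) i \<mu> (Suc j)) = - 1"
      using assms(2-6) qbracket_minus[of 1] by (simp add: shift_apply j_def qbracket_1)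
    then show ?thesis
      using ef_same[OF range(2) fij] by simp
  qed
  also have "e j (e i (e j (f j (f i (f j v))) + f i (f j v))) =
      e j (e i (e j (f j (f i (f j v))))) + e j (e i (f i (f j v)))"
    by (simp add: ef_linear)
  also have "e i (f i (f j v)) = f j v"
  proof -
    have "e i (f j v) = 0"
      using assms(2-6) by (intro e_eq_0_left[OF fj]) (auto simp: shift_apply j_def)
    then show ?thesis
      using e_f_eq[OF fj range(1)] assms(2-6) by (simp add: shift_apply j_def qbracket_1)
  qed
  also have "e j (e i (e j (f j (f i (f j v))))) = e i (e j (f j (f i v))) - e i (f i v)"
  proof -
    let ?w = "f i v"
    have w: "?w \<in> wt (shift j i \<mu>)"
      using wt_f[OF assms(1), of i] by (simp add: j_def)
    have ffj: "f j (f j v) = 0"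
      using assms(2-6) by (intro f_eq_0_left[OF fj]) (auto simp: shift_apply j_def)
    \<comment> \<open>One outer term of the Serre relation vanishes, since \<open>f j\<close> can
      act only once on \<open>v\<close>.\<close>
    then have f3: "f j (f j ?w) = ?two *s f j (f i (f j v))"
      using serre_f[OF range(2,1,6), of v] by simp
    have ffw: "f j (f j ?w) \<in> wt (shift (Suc j) j (shift (Suc j) i \<mu>))"
      using wt_f[OF wt_f[OF w, of j], of j] by simp
    have "e i (f j (f j ?w)) = 0"
      using assms(2-6) by (intro e_eq_0_left[OF ffw]) (auto simp: shift_apply j_def)
    then have e3: "e i (e j (e j (f j (f j ?w)))) = ?two *s e j (e i (e j (f j (f j ?w))))"
      using serre_e[OF range(2,1,6), of "f j (f j ?w)"] by simp
    have ew: "e j ?w \<in> wt (shift (Suc i) i (shift j (Suc j) \<mu>))"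
      using wt_e[OF w, of j] by (simp add: j_def shift_def fun_eq_iff algebra_simps)
    have few: "f j (e j ?w) \<in> wt (shift j i \<mu>)"
      using wt_f[OF wt_e[OF w, of j], of j] by simp
    have fw: "f j ?w \<in> wt (shift (Suc j) i \<mu>)"
      using wt_f[OF w, of j] by simp
    have eew: "e j (e j ?w) = 0"
      using assms(2-6) by (intro e_eq_0_left[OF ew]) (auto simp: shift_apply j_def)
    have a1: "e j (f j ?w) = f j (e j ?w) + ?w"
      using ef_same[OF range(2) w] assms(2-6) by (simp add: shift_apply j_def qbracket_1)
    have "qbracket qp (shift (Suc j) i \<mu> j - shift (Suc j) i \<mu> (Suc j)) = - 1"
      using assms(2-6) qbracket_minus[of 1] by (simp add: shift_apply j_def qbracket_1)
    \<comment> \<open>The two correction terms, \<open>+1\<close> from \<open>a1\<close> and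
      \<open>[1 - 2] = -1\<close>, cancel.\<close>
    then have a2: "e j (f j (f j ?w)) = f j (f j (e j ?w))"
      using ef_same[OF range(2) fw] by (simp add: a1 f_add)
    have a3: "e j (f j (e j ?w)) = qbracket qp 3 *s e j ?w"
      using e_f_eq[OF ew range(2) eew] assms(2-6) by (simp add: shift_apply j_def)
    have a4: "e j (f j (f j (e j ?w))) = (?two * ?two) *s f j (e j ?w)"
    proof -
      have "e j (f j (f j (e j ?w))) = f j (e j (f j (e j ?w))) + f j (e j ?w)"
        using ef_same[OF range(2) few] assms(2-6) by (simp add: shift_apply j_def qbracket_1)
      also have "\<dots> = (qbracket qp 3 + 1) *s f j (e j ?w)"
        by (simp add: a3 f_scale scale_left_distrib)
      finally show ?thesis by (simp only: qbracket_3)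
    qed
    \<comment> \<open>Each of the two Serre relations costs one factor \<open>[2]\<close>; the same
      \<open>[2]\<^sup>2\<close> comes from \<open>a4\<close> and is cancelled at the end.\<close>
    have "(?two * ?two) *s e j (e i (e j (f j (f i (f j v))))) =
        ?two *s e j (e i (e j (?two *s f j (f i (f j v)))))"
      by (simp add: e_scale)
    also have "\<dots> = e i (e j (e j (f j (f j ?w))))"
      by (simp only: f3[symmetric] e3)
    also have "\<dots> = (?two * ?two) *s e i (f j (e j ?w))"
      by (simp only: a2 a4 e_scale)
    also have "\<dots> = (?two * ?two) *s (e i (e j (f j ?w)) - e i ?w)"
      by (simp add: a1 e_add)
    finally show ?thesis
      using q_sum_inverse by (simp only: scale_cancel_left mult_eq_0_iff) simp
  qed
  finally show ?thesis .
qed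

text \<open>With \<open>U\<close>, \<open>T\<close> the two products \<open>E F\<close> and
  \<open>c = q\<^sup>-\<^sup>1\<close>, one has \<open>c U\<^sup>2 = c\<^sup>2 U + U\<close>,
  likewise for \<open>T\<close>, and \<open>U T U - T U T = U - T\<close>. After expansion these
  balance.\<close>

lemma crossing_R3:
  assumes "v \<in> wt \<mu>" "1 \<le> i" "Suc (Suc i) \<le> n" "\<mu> i = 1" "\<mu> (Suc i) = 1" "\<mu> (Suc (Suc i)) = 1"
  shows "crossing (i, True) (crossing (Suc i, True) (crossing (i, True) v)) =
    crossing (Suc i, True) (crossing (i, True) (crossing (Suc i, True) v))"
proof -
  let ?c = "inverse q" and ?u = "\<lambda>v. e i (f i v)" and ?t = "\<lambda>v. e (Suc i) (f (Suc i) v)"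
  have c: "?c *s (q + inverse q) *s w = (?c * ?c) *s w + w" for w
  proof -
    have "?c * (q + inverse q) = ?c * ?c + 1"
      using qp_nonzero[of 1] by (simp add: distrib_left)
    then have "?c *s (q + inverse q) *s w = (?c * ?c + 1) *s w"
      by (simp only: scale_scale)
    then show ?thesis by (simp add: scale_left_distrib)
  qed
  have uu: "?c *s ?u (?u v) = (?c * ?c) *s ?u v + ?u v"
    using e_f_e_f[OF assms(1), of i] assms c by simp
  have tt: "?c *s ?t (?t v) = (?c * ?c) *s ?t v + ?t v"
    using e_f_e_f[OF assms(1), of "Suc i"] assms c by simp
  have utu: "?t (?u (?t v)) = ?u (?t (?u v)) - ?u v + ?t v"
    using e_f_braid_same_side[OF assms] e_f_braid_other_side[OF assms] by simp
  show ?thesis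
    by (simp add: crossing_def ef_linear scale_right_diff_distrib uu tt utu algebra_simps)
qed

section \<open>Nested closures and their value\<close>

primrec cups :: "nat \<Rightarrow> 'v \<Rightarrow> 'v" where
  "cups 0 v = v"
| "cups (Suc k) v = cup k (cups k v)"

primrec caps :: "nat \<Rightarrow> 'v \<Rightarrow> 'v" where
  "caps 0 v = v"
| "caps (Suc k) v = caps k (cap k v)"

lemma wt_cups: "v \<in> wt (level_weight 0) \<Longrightarrow> k \<le> n \<Longrightarrow> cups k v \<in> wt (level_weight k)"
  by (induction k) (simp_all add: wt_cup)

lemma caps_scale: "caps k (c *s v) = c *s caps k v"
  by (induction k arbitrary: v) (simp_all add: cap_scale)

lemma caps_diff: "caps k (v - w) = caps k v - caps k w"
  by (induction k arbitrary: v w) (simp_all add: cap_diff)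

lemma level_weight_strand: "i \<in> {1..k} \<Longrightarrow> k \<le> n \<Longrightarrow> level_weight k i = 1"
  by (auto simp: level_weight_def zero_weight_def)

text \<open>Skein and braid relations hold on both sides, so \<open>skein_induct\<close> leaves the
  words \<open>flat\<close> and \<open>top\<close>, where a partial closure leads back to
  \<open>k\<close> strands.\<close>

theorem braid_closure_value:
  assumes homfly: "framed_homfly q (qp \<beta>) H" and v: "v \<in> wt (level_weight 0)"
    and "1 \<le> k" "k \<le> n" "is_braid k b"
  shows "caps k (braid_act b (cups k v)) = H (braid_closure k b) *s v"
  using assms(3-)
proof (induction k arbitrary: b rule: dec_induct)
  case base
  then have "b = []"
    by (simp add: is_braid_iff)
  moreover have "H (braid_closure 1 []) = qbracket qp \<beta>"
    using homfly_unknot[OF homfly] by (simp add: braid_closure_def qbracket_eq)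
  ultimately show ?case
    using cap_cup[OF v] base.prems by simp
next
  case (step k)
  let ?L = "level_weight (Suc k)" and ?V = "cups k v" and ?W = "cups (Suc k) v"
  have k: "k < n" "1 \<le> k" using step.hyps step.prems by simp_all
  have V: "?V \<in> wt (level_weight k)"
    using k by (intro wt_cups v) simp
  have W: "braid_act u ?W \<in> wt ?L" for u
    using k by (intro wt_braid_act wt_cups v) simp
  have L: "?L i = 1" if "i \<in> {1..Suc k}" for i
    using that k by (intro level_weight_strand) auto
  from step.prems(2) show ?case
  proof (induction b rule: skein_induct)
    case (skein u w i)
    let ?T = "\<lambda>b. caps (Suc k) (braid_act b ?W)"
    \<comment> \<open>Both sides have the same difference between the two signs, so the claim for
      one sign is equivalent to the claim for the other.\<close>
    have "?T (u @ (i, True) # w) - ?T (u @ (i, False) # w) = (inverse q - q) *s ?T (u @ w)"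
      by (simp only: caps_diff[symmetric] braid_act_diff[symmetric] braid_act_simps crossing_skein
          braid_act_scale caps_scale)
    also have "\<dots> = ((inverse q - q) * H (braid_closure (Suc k) (u @ w))) *s v"
      using skein by simp
    also have "\<dots> = H (braid_closure (Suc k) (u @ (i, True) # w)) *s v -
        H (braid_closure (Suc k) (u @ (i, False) # w)) *s v"
      using homfly_braid_skein[OF homfly skein(1)] by (simp add: scale_left_diff_distrib[symmetric])
    finally show ?case by auto
  next
    case (R2 u w i)
    have "crossing (i, False) (crossing (i, True) (braid_act u ?W)) = braid_act u ?W"
      using R2 k by (intro crossing_R2[OF W] L) (auto simp: is_braid_def)
    then show ?case
      using R2 homfly_braid_R2[OF homfly, of "Suc k" u i w] by simp
  next
    case (far u w i j)
    have "crossing (i, True) (crossing (j, True) x) = crossing (j, True) (crossing (i, True) x)" for x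
      using far k by (intro crossing_far) (auto simp: is_braid_def)
    then show ?case
      using far homfly_braid_far[OF homfly, of "Suc k" u i True j True w] by simp
  next
    case (braid u w i)
    have "crossing (i, True) (crossing (Suc i, True) (crossing (i, True) (braid_act u ?W))) =
      crossing (Suc i, True) (crossing (i, True) (crossing (Suc i, True) (braid_act u ?W)))"
      using braid k by (intro crossing_R3[OF W] L) (auto simp: is_braid_def)
    then show ?case
      using braid homfly_braid_R3[OF homfly, of "Suc k" u i w] by simp
  next
    case (flat x)
    have "caps (Suc k) (braid_act x ?W) = caps k (cap k (cup k (braid_act x ?V)))"
      using flat k by (simp add: braid_act_cup)
    also have "\<dots> = qbracket qp \<beta> *s caps k (braid_act x ?V)"
      using k by (simp add: cap_cup[OF wt_braid_act[OF V]] caps_scale)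
    also have "\<dots> = (qbracket qp \<beta> * H (braid_closure k x)) *s v"
      using step.IH[OF _ flat] k by simp
    also have "qbracket qp \<beta> * H (braid_closure k x) = H (braid_closure (Suc k) x)"
      using homfly_markov_circle[OF homfly k(2) flat] q_diff_inverse by (simp add: qbracket_eq)
    finally show ?case .
  next
    case (top x y)
    let ?x = "braid_act x ?V"
    have x: "?x \<in> wt (level_weight k)"
      by (rule wt_braid_act[OF V])
    \<comment> \<open>With \<open>x\<close> and \<open>y\<close> moved out of the last arc, only
      this crossing remains between \<open>cap k\<close> and \<open>cup k\<close>.\<close>
    have "cap k (crossing (k, True) (cup k ?x)) = inverse q *s cap k (cup k ?x) - cap k (e k (f k (cup k ?x)))"
      by (simp add: crossing_def cap_diff cap_scale)
    also have "\<dots> = (inverse q * qbracket qp \<beta> - qbracket qp (\<beta> - 1)) *s ?x"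
      using k by (simp add: cap_cup[OF x] cap_crossing_cup[OF x] scale_left_diff_distrib)
    finally have "cap k (crossing (k, True) (cup k ?x)) = inverse (qp \<beta>) *s ?x"
      by (simp only: qbracket_pred)
    moreover have "caps (Suc k) (braid_act (x @ (k, True) # y) ?W) =
        caps k (braid_act y (cap k (crossing (k, True) (cup k ?x))))"
      using top k by (simp add: braid_act_cup braid_act_cap)
    ultimately have "caps (Suc k) (braid_act (x @ (k, True) # y) ?W) =
        inverse (qp \<beta>) *s caps k (braid_act (x @ y) ?V)"
      by (simp add: braid_act_scale caps_scale)
    also have "\<dots> = (inverse (qp \<beta>) * H (braid_closure k (x @ y))) *s v"
      using step.IH[of "x @ y"] top k by simp
    also have "inverse (qp \<beta>) * H (braid_closure k (x @ y)) = H (braid_closure (Suc k) (x @ (k, True) # y))"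
      using homfly_markov_crossing[OF homfly k(2)] top by simp
    finally show ?case .
  qed
qed

end

section \<open>The universal module\<close>

lemma word_mult: "word u * word w = (word (u @ w) :: 'f::field free_alg)"
  by (simp add: word_def mult_single plus_list_def)

lemma word_Nil: "word [] = (1 :: 'f::field free_alg)"
  by (simp add: word_def flip: zero_list_def single_one)

lemma scalar_add: "scalar (c + d) = scalar c + scalar d"
  by (simp add: scalar_def single_add)

lemma scalar_mult: "scalar (c * d) = scalar c * scalar d"
  by (simp add: scalar_def mult_single plus_list_def)

lemma scalar_0: "scalar 0 = 0"
  by (simp add: scalar_def)

lemma scalar_1: "scalar 1 = 1"
  by (simp add: scalar_def flip: zero_list_def single_one)

lemma free_alg_induct [case_names zero add word]:
  fixes x :: "'f::field free_alg"
  assumes "P 0" and "\<And>x y. P x \<Longrightarrow> P y \<Longrightarrow> P (x + y)" and "\<And>c w. P (scalar c * word w)"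
  shows "P x"
proof (induction x rule: update_induct)
  case const
  show ?case by fact
next
  case (update x w c)
  have "Poly_Mapping.update w c x = x + Poly_Mapping.single w c"
    using update(1) by (intro poly_mapping_eqI)
      (auto simp: lookup_add lookup_update lookup_single in_keys_iff when_def)
  also have "Poly_Mapping.single w c = scalar c * word w"
    by (simp add: scalar_def word_def mult_single plus_list_def)
  finally show ?case using update assms by simp
qed

lemma scalar_commute: "x * scalar c = scalar c * (x :: 'f::field free_alg)"
proof (induction x rule: free_alg_induct)
  case (word d w)
  show ?case by (simp add: scalar_def word_def mult_single plus_list_def mult.commute)
qed (simp_all add: distrib_left distrib_right)

lemma scalar_left_commute: "x * (scalar c * y) = scalar c * (x * (y :: 'f::field free_alg))"
  by (metis mult.assoc scalar_commute)

interpretation free_alg: vector_space "\<lambda>c x. scalar c * (x :: 'f::field free_alg)"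
  by unfold_locales (simp_all add: distrib_left distrib_right scalar_add scalar_mult scalar_1 mult.assoc)

interpretation free_alg_pair: vector_space_pair "\<lambda>c x. scalar c * (x :: 'f::field free_alg)"
  "\<lambda>c x. scalar c * (x :: 'f::field free_alg)"
  by unfold_locales

section \<open>Null elements and weight spaces\<close>

lemma letter_target_shift:
  "letter_target (E i) \<mu> = shift i (Suc i) \<mu>"
  "letter_target (F i) \<mu> = shift (Suc i) i \<mu>"
  by (auto simp: shift_def)

lemma schur_path_appendD: "schur_path \<beta> k l \<nu> (u @ w) \<Longrightarrow> schur_path \<beta> k l \<nu> w"
  by (induction u) auto

lemma schur_path_admissible: "schur_path \<beta> k l \<nu> w \<Longrightarrow> admissible \<beta> k l (word_target w \<nu>)"
  by (cases w) (auto simp: word_target_def)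

lemma subspace_schur_null: "free_alg.subspace (schur_null qp \<beta> k l \<nu>)"
  by (auto simp: free_alg.subspace_def intro: schur_null.intros)

text \<open>Postcomposition preserves null elements, so letters act on the quotient; a word that has
  left the admissible weights stays excluded when it is prolonged.\<close>

lemma schur_null_word_mult:
  "x \<in> schur_null qp \<beta> k l \<nu> \<Longrightarrow> word u * x \<in> schur_null qp \<beta> k l \<nu>"
proof (induction rule: schur_null.induct)
  case zero
  then show ?case by (simp add: schur_null.zero)
next
  case (add x y)
  then show ?case by (simp add: distrib_left schur_null.add)
next
  case (scale x c)
  then show ?case by (simp add: scalar_left_commute schur_null.scale)
next
  case (leave w)
  then show ?case
    by (simp add: word_mult schur_null.leave) (meson schur_null.leave schur_path_appendD)
next
  case (rel r w u')
  then show ?case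
    using schur_null.rel[OF rel, where u = "u @ u'"] by (simp add: word_mult[symmetric] mult.assoc)
qed

text \<open>For relators that do not depend on the weight; these kill every element, not only those
  of a single weight.\<close>

lemma schur_null_relator:
  assumes "\<And>w. z \<in> relators qp (k + l) (word_target w \<nu>)"
  shows "z * x \<in> schur_null qp \<beta> k l \<nu>"
proof (induction x rule: free_alg_induct)
  case zero
  then show ?case by (simp add: schur_null.zero)
next
  case (add x y)
  then show ?case by (simp add: distrib_left schur_null.add)
next
  case (word c w)
  have "word [] * z * word w \<in> schur_null qp \<beta> k l \<nu>"
    by (rule schur_null.rel[OF assms])
  then show ?case by (simp add: scalar_left_commute schur_null.scale word_Nil)
qed

text \<open>Words leaving the admissible weights are included; they are null anyway.\<close>

definition weight_space :: "'w::ring_1 weight \<Rightarrow> 'w weight \<Rightarrow> 'f::field free_alg set" where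
  "weight_space \<nu> \<mu> = free_alg.span (word ` {w. word_target w \<nu> = \<mu>})"

lemma weight_space_induct [consumes 1, case_names word zero add scale]:
  assumes "x \<in> weight_space \<nu> \<mu>"
    and "\<And>w. word_target w \<nu> = \<mu> \<Longrightarrow> P (word w)"
    and "P 0" "\<And>x y. P x \<Longrightarrow> P y \<Longrightarrow> P (x + y)" "\<And>c x. P x \<Longrightarrow> P (scalar c * x)"
  shows "P x"
  using assms(1) unfolding weight_space_def
proof (rule free_alg.span_induct)
  show "free_alg.subspace {x. P x}"
    using assms by (simp add: free_alg.subspace_def)
qed (use assms(2) in auto)

lemma weight_space_word: "word w \<in> weight_space \<nu> (word_target w \<nu>)"
  unfolding weight_space_def by (intro free_alg.span_base) auto

lemma subspace_weight_space: "free_alg.subspace (weight_space \<nu> \<mu>)"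
  unfolding weight_space_def by (rule free_alg.subspace_span)

lemma weight_space_letter:
  assumes "x \<in> weight_space \<nu> \<mu>"
  shows "word [g] * x \<in> weight_space \<nu> (letter_target g \<mu>)"
  using assms
proof (induction rule: weight_space_induct)
  case (word w)
  then show ?case
    using weight_space_word[of "g # w" \<nu>] by (simp add: word_mult word_target_def)
qed (simp_all add: subspace_weight_space[unfolded free_alg.subspace_def] distrib_left scalar_left_commute)

lemma weight_space_inadmissible:
  assumes "x \<in> weight_space \<nu> \<mu>" "\<not> admissible \<beta> k l \<mu>"
  shows "x \<in> schur_null qp \<beta> k l \<nu>"
  using assms
proof (induction rule: weight_space_induct)
  case (word w)
  then show ?case by (intro schur_null.leave) (auto dest: schur_path_admissible)
qed (simp_all add: schur_null.intros)

text \<open>The diagonal relator contains the weight, hence the restriction to a single weight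
  space.\<close>

lemma weight_space_EF:
  assumes "x \<in> weight_space \<nu> \<mu>" "i \<in> {1..<k+l}"
  shows "(EE i * FF i - FF i * EE i - scalar (qbracket qp (\<mu> i - \<mu> (Suc i)))) * x \<in> schur_null qp \<beta> k l \<nu>"
  using assms
proof (induction rule: weight_space_induct)
  case (word w)
  have "word [] * (EE i * FF i - FF i * EE i - scalar (qbracket qp (\<mu> i - \<mu> (Suc i)))) * word w
      \<in> schur_null qp \<beta> k l \<nu>"
    using relators.EF[of i "k + l" i qp "word_target w \<nu>"] word by (intro schur_null.rel) simp
  then show ?case by (simp add: word_Nil)
qed (simp_all add: distrib_left scalar_left_commute schur_null.intros)

text \<open>
  A projection along the null elements realizes the quotient inside the free algebra, so that
  congruences become equations.
\<close>

lemma schur_null_projection: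
  obtains p :: "'f::field free_alg \<Rightarrow> 'f free_alg" where
    "\<And>x y. p (x + y) = p x + p y" "\<And>c x. p (scalar c * x) = scalar c * p x"
    "\<And>x. p x = 0 \<longleftrightarrow> x \<in> schur_null qp \<beta> k l \<nu>" "\<And>x. x - p x \<in> schur_null qp \<beta> k l \<nu>"
proof -
  let ?N = "schur_null qp \<beta> k l \<nu>"
  \<comment> \<open>\<open>g\<close> is a linear retraction onto the null elements; the projection
    sought is \<open>x - g x\<close>.\<close>
  obtain g where g: "range g \<subseteq> ?N" "Vector_Spaces.linear (\<lambda>c x. scalar c * x) (\<lambda>c x. scalar c * x) g" "\<forall>x\<in>?N. g x = x"
    using free_alg_pair.linear_exists_left_inverse_on[OF free_alg.linear_ident subspace_schur_null]
    by (metis inj_on_id2)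
  interpret g: Vector_Spaces.linear "\<lambda>c x. scalar c * x" "\<lambda>c x. scalar c * x" g by (rule g(2))
  show ?thesis
  proof
    show "x - g x = 0 \<longleftrightarrow> x \<in> ?N" for x
      using g(1,3) by (metis eq_iff_diff_eq_0 range_subsetD)
    show "x - (x - g x) \<in> ?N" for x
      using g(1) by (simp add: range_subsetD)
  qed (simp_all add: g.add g.scale algebra_simps)
qed

text \<open>\<open>braid_closure_value\<close> with \<open>n = k\<close>, in the module realized by
  \<open>p\<close>, for the class of the identity morphism.\<close>

lemma schur_eq_braid_closure:
  fixes qp :: "'w::ring_char_0 \<Rightarrow> 'f::field"
  assumes "quantum_power qp" and homfly: "framed_homfly (qp 1) (qp \<beta>) H"
    and "1 \<le> k" "is_braid k b"
  shows "schur_eq qp \<beta> k k (zero_weight \<beta> k) (braid_closure_elt qp k b) (scalar (H (braid_closure k b)))"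
proof -
  interpret quantum_power qp by fact
  let ?\<nu> = "zero_weight \<beta> k"
  let ?N = "schur_null qp \<beta> k k ?\<nu>"
  obtain p :: "'f free_alg \<Rightarrow> 'f free_alg" where
    p_add: "\<And>x y. p (x + y) = p x + p y" and p_scale: "\<And>c x. p (scalar c * x) = scalar c * p x"
    and p_0: "\<And>x. p x = 0 \<longleftrightarrow> x \<in> ?N" and p_null: "\<And>x. x - p x \<in> ?N"
    using schur_null_projection by blast
  have p_minus: "p (- x) = - p x" for x
    using p_add[of x "- x"] p_0[of 0] by (simp add: schur_null.zero minus_unique)
  have p_diff: "p (x - y) = p x - p y" for x y
    using p_add[of x "- y"] by (simp add: p_minus)
  have p_word: "p (word w * p x) = p (word w * x)" for w x
  proof -
    have "p (word w * (x - p x)) = 0"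
      by (simp add: p_0 schur_null_word_mult[OF p_null])
    then show ?thesis by (simp add: right_diff_distrib p_diff)
  qed
  \<comment> \<open>Multiplication followed by \<open>p\<close>, so that the range of
    \<open>p\<close> serves as the quotient.\<close>
  let ?e = "\<lambda>i v. p (EE i * v)" and ?f = "\<lambda>i v. p (FF i * v)"
  have relator: "p (z * x) = 0" if "\<And>w. z \<in> relators qp (k + k) (word_target w ?\<nu>)" for z x
    using schur_null_relator[OF that] by (simp add: p_0)
  interpret schur_module qp "\<lambda>c x. scalar c * x" \<beta> k ?e ?f "\<lambda>\<mu>. p ` weight_space ?\<nu> \<mu>"
  proof unfold_locales
    fix i j c and v w :: "'f free_alg" and \<mu> :: "'w weight"
    show "?e i (v + w) = ?e i v + ?e i w" "?f i (v + w) = ?f i v + ?f i w"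
      by (simp_all add: distrib_left p_add)
    show "?e i (scalar c * v) = scalar c * ?e i v" "?f i (scalar c * v) = scalar c * ?f i v"
      by (simp_all add: scalar_left_commute p_scale)
    show "free_alg.subspace (p ` weight_space ?\<nu> \<mu>)"
    proof -
      have "Vector_Spaces.linear (\<lambda>c x. scalar c * x) (\<lambda>c x. scalar c * x) p"
        by (simp add: Vector_Spaces.linear_iff free_alg.vector_space_axioms p_add p_scale)
      then show ?thesis
        using free_alg_pair.linear_subspace_image subspace_weight_space by blast
    qed
    show "?e i v \<in> p ` weight_space ?\<nu> (shift i (Suc i) \<mu>)" if "v \<in> p ` weight_space ?\<nu> \<mu>"
    proof -
      from that obtain x where "x \<in> weight_space ?\<nu> \<mu>" "v = p x" by blast
      then show ?thesis
        using weight_space_letter[of x ?\<nu> \<mu> "E i"] by (simp only: p_word letter_target_shift imageI)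
    qed
    show "?f i v \<in> p ` weight_space ?\<nu> (shift (Suc i) i \<mu>)" if "v \<in> p ` weight_space ?\<nu> \<mu>"
    proof -
      from that obtain x where "x \<in> weight_space ?\<nu> \<mu>" "v = p x" by blast
      then show ?thesis
        using weight_space_letter[of x ?\<nu> \<mu> "F i"] by (simp only: p_word letter_target_shift imageI)
    qed
    show "v = 0" if "v \<in> p ` weight_space ?\<nu> \<mu>" "\<not> admissible \<beta> k k \<mu>"
      using that weight_space_inadmissible p_0 by blast
    show "?e i (?f i v) = ?f i (?e i v) + scalar (qbracket qp (\<mu> i - \<mu> (Suc i))) * v"
      if i: "i \<in> {1..<k+k}" and v: "v \<in> p ` weight_space ?\<nu> \<mu>"
    proof -
      from v obtain x where x: "x \<in> weight_space ?\<nu> \<mu>" "v = p x" by blast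
      have "p ((EE i * FF i - FF i * EE i - scalar (qbracket qp (\<mu> i - \<mu> (Suc i)))) * x) = 0"
        using weight_space_EF[OF x(1) i] by (simp add: p_0)
      then show ?thesis
        by (simp add: x(2) p_word left_diff_distrib p_diff p_add p_scale mult.assoc algebra_simps)
    qed
    show "?e i (?f j v) = ?f j (?e i v)" if "i \<in> {1..<k+k}" "j \<in> {1..<k+k}" "i \<noteq> j"
    proof -
      have "p ((EE i * FF j - FF j * EE i - scalar 0) * v) = 0"
      proof (rule relator)
        show "EE i * FF j - FF j * EE i - scalar 0 \<in> relators qp (k + k) (word_target w ?\<nu>)" for w
          using relators.EF[OF that(1,2), of qp "word_target w ?\<nu>"] that(3) by simp
      qed
      then show ?thesis
        by (simp add: p_word left_diff_distrib p_diff mult.assoc scalar_0)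
    qed
    show "?e i (?e j v) = ?e j (?e i v)"
      if "i \<in> {1..<k+k}" "j \<in> {1..<k+k}" "Suc i < j \<or> Suc j < i"
    proof -
      have "p ((EE i * EE j - EE j * EE i) * v) = 0"
        by (intro relator relators.far_E that)
      then show ?thesis
        by (simp add: p_word left_diff_distrib p_diff mult.assoc)
    qed
    show "?f i (?f j v) = ?f j (?f i v)"
      if "i \<in> {1..<k+k}" "j \<in> {1..<k+k}" "Suc i < j \<or> Suc j < i"
    proof -
      have "p ((FF i * FF j - FF j * FF i) * v) = 0"
        by (intro relator relators.far_F that)
      then show ?thesis
        by (simp add: p_word left_diff_distrib p_diff mult.assoc)
    qed
    show "?e i (?e i (?e j v)) + ?e j (?e i (?e i v)) = scalar (q + inverse q) * ?e i (?e j (?e i v))"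
      if "i \<in> {1..<k+k}" "j \<in> {1..<k+k}" "j = Suc i \<or> i = Suc j"
    proof -
      have "p ((EE i * EE i * EE j - scalar (q + inverse q) * (EE i * EE j * EE i) + EE j * EE i * EE i) * v) = 0"
        by (intro relator relators.Serre_E that)
      then show ?thesis
        by (simp add: p_word left_diff_distrib distrib_right p_diff p_add p_scale mult.assoc algebra_simps)
    qed
    show "?f i (?f i (?f j v)) + ?f j (?f i (?f i v)) = scalar (q + inverse q) * ?f i (?f j (?f i v))"
      if "i \<in> {1..<k+k}" "j \<in> {1..<k+k}" "j = Suc i \<or> i = Suc j"
    proof -
      have "p ((FF i * FF i * FF j - scalar (q + inverse q) * (FF i * FF j * FF i) + FF j * FF i * FF i) * v) = 0"
        by (intro relator relators.Serre_F that)
      then show ?thesis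
        by (simp add: p_word left_diff_distrib distrib_right p_diff p_add p_scale mult.assoc algebra_simps)
    qed
  qed
  have word_append: "p (word (u @ w) * x) = p (word u * p (word w * x))" for u w x
    by (simp add: p_word word_mult[symmetric] mult.assoc)
  have p_p: "p (p x) = p x" for x
    using p_word[of "[]" x] by (simp add: word_Nil)
  have p_E: "p (foldr ?e is v) = foldr ?e is v" if "p v = v" for "is" v
    using that by (cases "is") (simp_all add: p_p)
  have word_E: "p (word (map E is) * v) = foldr ?e is v" if "p v = v" for "is" v
    using that
  proof (induction "is")
    case (Cons i "is")
    then show ?case using word_append[of "[E i]" "map E is" v] by simp
  qed (simp add: word_Nil)
  have p_F: "p (foldr ?f is v) = foldr ?f is v" if "p v = v" for "is" v
    using that by (cases "is") (simp_all add: p_p)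
  have word_F: "p (word (map F is) * v) = foldr ?f is v" if "p v = v" for "is" v
    using that
  proof (induction "is")
    case (Cons i "is")
    then show ?case using word_append[of "[F i]" "map F is" v] by simp
  qed (simp add: word_Nil)
  \<comment> \<open>\<open>cup\<close> counts the strands outside the new arc,
    \<open>cup_elt\<close> counts outwards from the middle; hence \<open>m\<close> against
    \<open>k - m\<close>.\<close>
  have cup: "p (cup_elt k (k - m) * x) = cup m (p x)" if "m < k" for m x
  proof -
    have "p (cup_elt k (k - m) * x) =
      p (word (map E [k+1-(k-m)..<k]) * p (word (map E (rev [k+1..<k+(k-m)])) * p (EE k * p x)))"
      unfolding cup_elt_def by (simp only: word_append p_word)
    also have "\<dots> = foldr ?e [k+1-(k-m)..<k] (foldr ?e (rev [k+1..<k+(k-m)]) (?e k (p x)))"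
      by (simp only: word_E p_E p_p)
    finally show ?thesis using that by (simp add: cup_def Suc_diff_le)
  qed
  have cap: "p (cap_elt k (k - m) * x) = cap m (p x)" if "m < k" for m x
  proof -
    have "p (cap_elt k (k - m) * x) =
      p (FF k * p (word (map F [k+1..<k+(k-m)]) * p (word (map F (rev [k+1-(k-m)..<k])) * p x)))"
      unfolding cap_elt_def by (simp only: word_append p_word)
    also have "\<dots> = ?f k (foldr ?f [k+1..<k+(k-m)] (foldr ?f (rev [k+1-(k-m)..<k]) (p x)))"
      by (simp only: word_F p_F p_p)
    finally show ?thesis using that by (simp add: cap_def Suc_diff_le)
  qed
  \<comment> \<open>The outermost cup, of index \<open>k\<close>, stands last in the product and
    acts first, so the list grows at the front.\<close>
  have upt: "[k+1-Suc m..<k+1] = (k - m) # [k+1-m..<k+1]" if "m < k" for m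
    using that by (simp add: upt_conv_Cons Suc_diff_le del: upt_Suc)
  have cups: "p (prod_list (map (cup_elt k) [k+1-m..<k+1]) * x) = cups m (p x)" if "m \<le> k" for m x
    using that
  proof (induction m)
    case (Suc m)
    then show ?case by (simp only: upt Suc_le_eq) (simp add: mult.assoc cup)
  qed simp
  have caps: "p (prod_list (map (cap_elt k) (rev [k+1-m..<k+1])) * x) = caps m (p x)" if "m \<le> k" for m x
    using that
  proof (induction m arbitrary: x)
    case (Suc m)
    then show ?case by (simp only: upt Suc_le_eq) (simp add: mult.assoc cap)
  qed simp
  have braid: "p (braid_elt qp b * x) = braid_act b (p x)" for x
  proof (induction b arbitrary: x)
    case (Cons g b)
    obtain i s where g: "g = (i, s)" by fastforce
    have "p (braid_elt qp (g # b) * x) =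
        braid_act b (p ((scalar (if s then inverse q else q) - EE i * FF i) * x))"
      using Cons by (simp add: braid_elt_def g mult.assoc)
    also have "p ((scalar (if s then inverse q else q) - EE i * FF i) * x) = crossing g (p x)"
      by (simp add: crossing_def g left_diff_distrib p_diff p_scale p_word mult.assoc)
    finally show ?case by simp
  qed (simp add: braid_elt_def)
  \<comment> \<open>The empty word is the identity of the zero weight, so a statement about this
    vector is one about endomorphisms.\<close>
  have "p 1 \<in> p ` weight_space ?\<nu> (level_weight 0)"
    using weight_space_word[of "[]" ?\<nu>]
    by (intro imageI) (simp add: word_Nil level_weight_0 word_target_def)
  from braid_closure_value[OF homfly this assms(3) order_refl assms(4)]
  have "p (braid_closure_elt qp k b * 1) = p (scalar (H (braid_closure k b)) * 1)"
    using caps[of k] cups[of k 1]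
    by (simp add: braid_closure_elt_def mult.assoc braid p_scale del: mult_1_right upt_Suc)
  then have "p (braid_closure_elt qp k b - scalar (H (braid_closure k b))) = 0"
    by (simp add: p_diff)
  then show ?thesis
    by (simp add: schur_eq_def p_0)
qed

section \<open>The two base fields\<close>

lemma Fract_X_nonzero: "Fract [:0, 1 :: 'a::field:] 1 \<noteq> 0"
  by (simp add: Zero_fract_def eq_fract)

lemma quantum_power_int: "quantum_power qpow_int"
proof
  show "qpow_int (x + y) = qpow_int x * qpow_int y" for x y
    by (simp add: qpow_int_def Fract_X_nonzero power_int_add)
  show "qpow_int x \<noteq> 0" for x
    by (simp add: qpow_int_def Fract_X_nonzero)
  show "qpow_int 1 * qpow_int 1 \<noteq> 1" "qpow_int 1 * qpow_int 1 \<noteq> - 1"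
    by (simp_all add: qpow_int_def One_fract_def eq_fract one_pCons)
qed

text \<open>Coefficients are additive, and \<open>q\<close> is a constant in the variable
  \<open>q\<^sup>\<beta>\<close>; by injectivity of constants the conditions on
  \<open>q\<^sup>2\<close> carry over from \<open>qpow_int\<close>.\<close>

lemma quantum_power_gen: "quantum_power qpow_gen"
proof
  interpret int: quantum_power qpow_int by (rule quantum_power_int)
  have const: "Fract [:c * d:] 1 = Fract [:c:] 1 * (Fract [:d:] 1 :: 'a::field poly fract)" for c d
    by (simp add: mult.commute)
  show "qpow_gen (x + y) = qpow_gen x * qpow_gen y" for x y
    by (simp add: qpow_gen_def int.qp_add const Fract_X_nonzero power_int_add del: mult_fract)
  show "qpow_gen x \<noteq> 0" for x
    using int.qp_nonzero by (simp add: qpow_gen_def Fract_X_nonzero) (simp add: Zero_fract_def eq_fract)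
  show "qpow_gen 1 * qpow_gen 1 \<noteq> 1" "qpow_gen 1 * qpow_gen 1 \<noteq> - 1"
  proof -
    have inj: "Fract [:c:] 1 = (Fract [:d:] 1 :: 'a::field poly fract) \<longleftrightarrow> c = d" for c d
      by (simp add: eq_fract)
    have one: "1 = (Fract [:1:] 1 :: complex poly fract poly fract)"
      "- 1 = (Fract [:- 1:] 1 :: complex poly fract poly fract)"
      by (simp_all add: One_fract_def one_pCons)
    have "qpow_gen 1 * qpow_gen 1 = Fract [:qpow_int 1 * qpow_int 1:] 1"
      by (simp add: qpow_gen_def)
    then show "qpow_gen 1 * qpow_gen 1 \<noteq> 1" "qpow_gen 1 * qpow_gen 1 \<noteq> - 1"
      using int.q_square by (simp_all only: one(2) inj not_False_eq_True, simp_all only: one(1) inj not_False_eq_True)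
  qed
qed

theorem theorem3p8:
  fixes k :: nat and b :: braid
  assumes "k \<ge> 1" and "is_braid k b"
  shows "(\<forall>H. framed_homfly (qpow_gen 1) (qpow_gen beta_gen) H \<longrightarrow>
            schur_eq qpow_gen beta_gen k k (zero_weight beta_gen k)
              (braid_closure_elt qpow_gen k b) (scalar (H (braid_closure k b)))) \<and>
         (\<forall>m::int. m \<ge> 2 \<longrightarrow>
            (\<forall>H. framed_homfly (qpow_int 1) (qpow_int m) H \<longrightarrow>
              schur_eq qpow_int m k k (zero_weight m k)
                (braid_closure_elt qpow_int k b) (scalar (H (braid_closure k b)))))"
  by (intro conjI allI impI schur_eq_braid_closure quantum_power_gen quantum_power_int assms)

end
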